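(* Let $n\ge 2$, let $(R,J,a)$ be a Riesz triple on the unit sphere $S_n$ of $\mathbb{C}^n$, with $R=\{R_j\}_{j=1}^\infty$, $J=\{j_k\}_{k=1}^\infty$, $a=\{a_k\}_{k=1}^\infty$, and let $\Pi(R,J,a)$ be the corresponding Riesz product. Then \[ \dim_{\mathcal H}\Pi(R,J,a)\ \ge\ 2n-1-\limsup_{k\to\infty}\left(\frac{1}{2\log j_k}\sum_{\ell=1}^{k-1}|a_\ell|^2\right). \]
   Context: Let $n\ge 2$, $S=S_n=\{\zeta\in\mathbb{C}^n:|\zeta|=1\}$ with the Euclidean metric, and let $\sigma$ be the normalized Lebesgue (rotation-invariant probability) measure on $S$; $L^p(S)=L^p(\sigma)$. $H(j,0)$ is the space of (restrictions to $S$ of) homogeneous holomorphic polynomials of degree $j$ in $z_1,\dots,z_n$. A Ryll--Wojtaszczyk sequence with constant $\delta\in(0,1)$ is a sequence $\{R_j\}_{j=1}^\infty$ such that, for all $j=1,2,\dots$: $R_j\in H(j,0)$, $\|R_j\|_{L^\infty(S)}=1$, and $\|R_j\|_{L^2(S)}\ge\delta$. A Riesz triple $(R,J,a)$ consists of a Ryll--Wojtaszczyk sequence $R=\{R_j\}_{j=1}^\infty$ (with some constant $\delta\in(0,1)$), a sequence $J=\{j_k\}_{k=1}^\infty$ of positive integers with $j_{k+1}/j_k\ge 3$ for all $k$, and a sequence $a=\{a_k\}_{k=1}^\infty$ in the open unit disk $\mathbb{D}\subset\mathbb{C}$. The Riesz product \[ \Pi(R,J,a)=\prod_{k=1}^\infty\left(\frac{\overline{a}_k\overline{R}_{j_k}}{2}+1+\frac{a_kR_{j_k}}{2}\right)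 \] is the probability measure on $S$ that is the weak*-limit, as $N\to\infty$, of the measures $\prod_{k=1}^N\left(\frac{\overline{a}_k\overline{R}_{j_k}}{2}+1+\frac{a_kR_{j_k}}{2}\right)\sigma$ (this limit is known to exist). For a finite positive Borel measure $\mu$ on $S$, its Hausdorff dimension is $\dim_{\mathcal H}\mu=\inf\{\dim_{\mathcal H}E: E\subset S \text{ Borel},\ \mu(E)>0\}$, where $\dim_{\mathcal H}E$ is the Hausdorff dimension of the set $E$. *)

theory Defs
  imports "HOL-Probability.Probability"
begin

section \<open>Normalized Lebesgue measure on the unit sphere\<close>

text \<open>
  The library has no surface measure. The normalized one is defined by polar coordinates, as the
  image of the uniform distribution on the punctured unit ball under \<open>x \<mapsto> x / |x|\<close>; it is
  a measure on the Borel sets of the sphere itself. That it is the rotation-invariant probability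
  measure is \<open>prob_space_sphere_measure\<close> and \<open>sphere_measure_rotation_invariant\<close>.
\<close>

definition sphere_measure :: "'a::euclidean_space measure" where
  "sphere_measure =
     distr (uniform_measure (restrict_space lborel (ball 0 1 - {0})) (ball 0 1 - {0}))
       (restrict_space borel (sphere 0 1)) sgn"

lemma space_sphere_measure [simp]:
  "space (sphere_measure :: 'a::euclidean_space measure) = sphere 0 1"
  by (simp add: sphere_measure_def space_restrict_space)

lemma sets_sphere_measure [simp, measurable_cong]:
  "sets (sphere_measure :: 'a::euclidean_space measure) = sets (restrict_space borel (sphere 0 1))"
  by (simp add: sphere_measure_def)

lemma emeasure_punctured_ball:
  "emeasure lborel (ball 0 1 - {0 :: 'a::euclidean_space}) \<noteq> 0"
  "emeasure lborel (ball 0 1 - {0 :: 'a::euclidean_space}) \<noteq> \<infinity>"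
proof -
  have "emeasure lborel (ball 0 1 - {0 :: 'a}) = emeasure lborel (ball (0 :: 'a) 1)"
    by (subst emeasure_Diff) auto
  also have "\<dots> = ennreal (measure lborel (ball (0 :: 'a) 1))"
    using emeasure_lborel_ball_finite[of "0 :: 'a" 1]
    by (simp add: emeasure_eq_ennreal_measure less_top)
  finally have *: "emeasure lborel (ball 0 1 - {0 :: 'a})
    = ennreal (measure lborel (ball (0 :: 'a) 1))" .
  have "measure lborel (ball (0 :: 'a) 1) > 0"
    using content_ball_pos[of 1 "0 :: 'a"] by (simp add: measure_completion)
  with * show "emeasure lborel (ball 0 1 - {0 :: 'a}) \<noteq> 0" by simp
  from * show "emeasure lborel (ball 0 1 - {0 :: 'a}) \<noteq> \<infinity>" by simp
qed

lemma measurable_sgn_sphere: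
  "sgn \<in> restrict_space lborel (ball 0 1 - {0 :: 'a::euclidean_space})
     \<rightarrow>\<^sub>M restrict_space borel (sphere 0 1)"
proof (rule measurable_restrict_space2)
  show "sgn \<in> restrict_space lborel (ball 0 1 - {0 :: 'a}) \<rightarrow>\<^sub>M borel"
    unfolding sgn_div_norm by (intro measurable_restrict_space1) auto
qed (auto simp: space_restrict_space norm_sgn)

lemma emeasure_sphere_measure:
  assumes "A \<in> sets (restrict_space borel (sphere 0 1 :: 'a::euclidean_space set))"
  shows "emeasure sphere_measure A =
    emeasure lborel {x \<in> ball 0 1 - {0}. sgn x \<in> A} / emeasure lborel (ball 0 1 - {0 :: 'a})"
proof -
  let ?B = "ball 0 1 - {0 :: 'a}" and ?M = "restrict_space lborel (ball 0 1 - {0 :: 'a})"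
  have B: "?B \<in> sets ?M" by (auto simp: sets_restrict_space)
  have m: "sgn -` A \<inter> ?B \<in> sets ?M"
    using measurable_sets[OF measurable_sgn_sphere assms] by (simp add: space_restrict_space)
  have meas: "sgn \<in> uniform_measure ?M ?B \<rightarrow>\<^sub>M restrict_space borel (sphere 0 1)"
    using measurable_sgn_sphere by (simp add: uniform_measure_def)
  have "emeasure sphere_measure A = emeasure (uniform_measure ?M ?B) (sgn -` A \<inter> ?B)"
    unfolding sphere_measure_def
    by (subst emeasure_distr[OF meas assms]) (simp add: space_restrict_space)
  also have "\<dots> = emeasure ?M (sgn -` A \<inter> ?B) / emeasure ?M ?B"
    by (subst emeasure_uniform_measure[OF B m]) (simp add: Int_ac)
  also have "\<dots> = emeasure lborel (sgn -` A \<inter> ?B) / emeasure lborel ?B"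
    by (subst (1 2) emeasure_restrict_space) auto
  finally show ?thesis by (simp add: vimage_def Int_def conj_commute)
qed

lemma prob_space_sphere_measure: "prob_space (sphere_measure :: 'a::euclidean_space measure)"
proof
  have "sphere 0 1 \<in> sets (restrict_space borel (sphere 0 1 :: 'a set))"
    by (auto simp: sets_restrict_space)
  moreover have "{x \<in> ball 0 1 - {0 :: 'a}. sgn x \<in> sphere 0 1} = ball 0 1 - {0}"
    by (auto simp: norm_sgn)
  ultimately show "emeasure (sphere_measure :: 'a measure) (space sphere_measure) = 1"
    using emeasure_punctured_ball[where 'a = 'a]
    by (simp add: emeasure_sphere_measure ennreal_divide_self less_top del: mem_Collect_eq mem_sphere_0)
qed

lemma emeasure_lborel_orthogonal:
  fixes f :: "'a::euclidean_space \<Rightarrow> 'a"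
  assumes f: "orthogonal_transformation f" and A: "A \<in> sets borel"
  shows "emeasure lborel (f -` A) = emeasure lborel A"
proof -
  have lin: "linear f" using f by (simp add: orthogonal_transformation_linear)
  have [measurable]: "f \<in> borel_measurable borel"
    by (intro borel_measurable_continuous_onI linear_continuous_on linear_linear[THEN iffD2] lin)
  define M where "M = distr lborel borel f"
  define B where "B = ball (0 :: 'a) 1"
  have [measurable]: "A \<in> sets borel" "B \<in> sets borel" using A by (auto simp: B_def)
  have sM [measurable_cong]: "sets M = sets borel" and spM: "space M = UNIV"
    by (simp_all add: M_def)
  have M: "emeasure M X = emeasure lborel (f -` X)" if "X \<in> sets borel" for X
    using that by (simp add: M_def emeasure_distr)
  have trans: "(\<integral>\<^sup>+x. g (c + x) \<partial>(lborel :: 'a measure)) = (\<integral>\<^sup>+x. g x \<partial>lborel)"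
    if [measurable]: "g \<in> borel_measurable borel" for g and c :: 'a
    by (subst lborel_distr_plus[symmetric, of c], subst nn_integral_distr) auto
  have transM: "(\<integral>\<^sup>+x. g (c + x) \<partial>M) = (\<integral>\<^sup>+x. g x \<partial>M)"
    if [measurable]: "g \<in> borel_measurable borel" for g and c :: 'a
  proof -
    obtain d where d: "c = f d"
      using orthogonal_transformation_surj[OF f] by (metis surj_def)
    have "(\<integral>\<^sup>+x. g (c + x) \<partial>M) = (\<integral>\<^sup>+x. g (f (d + x)) \<partial>lborel)"
      unfolding M_def by (subst nn_integral_distr) (auto simp: d linear_add[OF lin])
    also have "\<dots> = (\<integral>\<^sup>+x. g (f x) \<partial>lborel)" by (rule trans) simp
    also have "\<dots> = (\<integral>\<^sup>+x. g x \<partial>M)"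
      unfolding M_def by (subst nn_integral_distr) auto
    finally show ?thesis .
  qed
  have vB: "f -` ball 0 r = ball 0 r" for r
    using orthogonal_transformation_norm[OF f] by auto
  have MB: "emeasure M B = emeasure lborel B"
    by (simp add: M B_def vB)
  interpret M: sigma_finite_measure M
  proof
    show "\<exists>X. countable X \<and> X \<subseteq> sets M \<and> \<Union>X = space M \<and> (\<forall>a\<in>X. emeasure M a \<noteq> \<infinity>)"
    proof (intro exI conjI)
      show "\<Union>(range (\<lambda>n. ball (0::'a) (real n))) = space M"
        by (auto simp: spM reals_Archimedean2)
      show "\<forall>a\<in>range (\<lambda>n. ball (0::'a) (real n)). emeasure M a \<noteq> \<infinity>"
        using emeasure_lborel_ball_finite[of "0::'a"] by (auto simp: M vB less_top[symmetric])
    qed (auto simp: sM)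
  qed
  interpret L: sigma_finite_measure "lborel :: 'a measure" by standard
  interpret P: pair_sigma_finite "lborel :: 'a measure" M by standard
  have "emeasure lborel B * emeasure M A = (\<integral>\<^sup>+x. indicator B x * (\<integral>\<^sup>+y. indicator A y \<partial>M) \<partial>lborel)"
    by (simp add: nn_integral_multc sM)
  also have "\<dots> = (\<integral>\<^sup>+x. indicator B x * (\<integral>\<^sup>+y. indicator A (x + y) \<partial>M) \<partial>lborel)"
    by (intro nn_integral_cong arg_cong2[where f = "(*)"] refl transM[symmetric]) simp
  also have "\<dots> = (\<integral>\<^sup>+x. (\<integral>\<^sup>+y. indicator B x * indicator A (x + y) \<partial>M) \<partial>lborel)"
    by (intro nn_integral_cong nn_integral_cmult[symmetric]) measurable
  also have "\<dots> = (\<integral>\<^sup>+y. (\<integral>\<^sup>+x. indicator B x * indicator A (x + y) \<partial>lborel) \<partial>M)"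
    by (rule P.Fubini'[symmetric]) measurable
  also have "\<dots> = (\<integral>\<^sup>+y. (\<integral>\<^sup>+x. indicator B (x - y) * indicator A x \<partial>lborel) \<partial>M)"
  proof (rule nn_integral_cong)
    fix y
    show "(\<integral>\<^sup>+x. indicator B x * indicator A (x + y) \<partial>lborel)
        = (\<integral>\<^sup>+x. indicator B (x - y) * indicator A x \<partial>lborel)"
      using trans[of "\<lambda>x. indicator B (x - y) * indicator A x" y] by (simp add: add.commute)
  qed
  also have "\<dots> = (\<integral>\<^sup>+x. (\<integral>\<^sup>+y. indicator B (x - y) * indicator A x \<partial>M) \<partial>lborel)"
    by (rule P.Fubini') measurable
  also have "\<dots> = (\<integral>\<^sup>+x. emeasure M B * indicator A x \<partial>lborel)"
  proof (rule nn_integral_cong)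
    fix x
    have "(\<integral>\<^sup>+y. indicator B (x - y) * indicator A x \<partial>M)
        = (\<integral>\<^sup>+y. indicator B (x - (x + y)) * indicator A x \<partial>M)"
      by (rule transM[symmetric]) measurable
    also have "\<dots> = (\<integral>\<^sup>+y. indicator B y * indicator A x \<partial>M)"
      by (intro nn_integral_cong) (simp add: B_def indicator_def)
    also have "\<dots> = emeasure M B * indicator A x"
      by (simp add: nn_integral_multc sM)
    finally show "(\<integral>\<^sup>+y. indicator B (x - y) * indicator A x \<partial>M) = emeasure M B * indicator A x" .
  qed
  also have "\<dots> = emeasure lborel B * emeasure lborel A"
    by (simp add: nn_integral_cmult MB)
  finally have eq: "emeasure lborel B * emeasure M A = emeasure lborel B * emeasure lborel A" .
  have "emeasure lborel B \<noteq> 0" "emeasure lborel B \<noteq> \<infinity>"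
    using emeasure_punctured_ball(1)[where 'a = 'a]
      emeasure_mono[of "ball 0 1 - {0 :: 'a}" B lborel] emeasure_lborel_ball_finite[of "0 :: 'a" 1]
    by (auto simp: B_def)
  with eq have "emeasure M A = emeasure lborel A"
    by (simp add: ennreal_mult_cancel_left)
  then show ?thesis by (simp add: M A)
qed

lemma sphere_measure_rotation_invariant:
  fixes f :: "'a::euclidean_space \<Rightarrow> 'a"
  assumes f: "orthogonal_transformation f"
  shows "distr sphere_measure sphere_measure f = sphere_measure"
proof (rule measure_eqI)
  let ?S = "restrict_space borel (sphere 0 1 :: 'a set)"
  have lin: "linear f" using f by (simp add: orthogonal_transformation_linear)
  have norm: "norm (f x) = norm x" for x
    using f by (simp add: orthogonal_transformation_norm)
  have [measurable]: "f \<in> borel_measurable borel"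
    by (intro borel_measurable_continuous_onI linear_continuous_on linear_linear[THEN iffD2] lin)
  have fS: "f \<in> ?S \<rightarrow>\<^sub>M ?S"
    by (intro measurable_restrict_space2 measurable_restrict_space1)
       (auto simp: space_restrict_space norm)
  then have fS': "f \<in> sphere_measure \<rightarrow>\<^sub>M sphere_measure"
    by (simp cong: measurable_cong_sets)
  fix A assume "A \<in> sets (distr sphere_measure sphere_measure f)"
  then have A: "A \<in> sets ?S" by simp
  let ?T = "\<lambda>A. {x \<in> ball 0 1 - {0 :: 'a}. sgn x \<in> A}"
  have "sgn -` A \<inter> (ball 0 1 - {0}) \<in> sets (restrict_space lborel (ball 0 1 - {0 :: 'a}))"
    using measurable_sets[OF measurable_sgn_sphere A] by (simp add: space_restrict_space)
  then have "sgn -` A \<inter> (ball 0 1 - {0}) \<in> sets borel"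
    by (subst (asm) sets_restrict_space_iff) auto
  then have TA: "?T A \<in> sets borel" by (simp add: vimage_def Int_def conj_commute)
  have pre: "f -` A \<inter> sphere 0 1 \<in> sets ?S"
    using measurable_sets[OF fS A] by (simp add: space_restrict_space)
  have sgnf: "f (sgn x) = sgn (f x)" for x
    by (simp add: sgn_div_norm linear_scale[OF lin] norm)
  have f0: "f x = 0 \<longleftrightarrow> x = 0" for x using norm[of x] by (metis norm_eq_zero)
  have "?T (f -` A \<inter> sphere 0 1) = f -` ?T A"
    by (auto simp: sgnf norm f0 norm_sgn)
  then have "emeasure lborel (?T (f -` A \<inter> sphere 0 1)) = emeasure lborel (?T A)"
    using emeasure_lborel_orthogonal[OF f TA] by metis
  then have "emeasure sphere_measure (f -` A \<inter> sphere 0 1) = emeasure sphere_measure A"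
    by (simp only: emeasure_sphere_measure[OF A] emeasure_sphere_measure[OF pre])
  then show "emeasure (distr sphere_measure sphere_measure f) A = emeasure sphere_measure A"
    using A by (simp add: emeasure_distr[OF fS'])
qed simp


section \<open>Hausdorff dimension of sets and measures\<close>

text \<open>
  The summand \<open>(diam U)\<^sup>s\<close>, with \<open>0\<^sup>0 = 1\<close> for nonempty sets and value \<open>0\<close> for the empty set
  (in the library \<open>0 powr 0 = 0\<close>).
\<close>

definition hausdorff_gauge :: "real \<Rightarrow> 'a::metric_space set \<Rightarrow> ennreal" where
  "hausdorff_gauge s U =
     (if U = {} then 0 else if s = 0 then 1 else ennreal (diameter U powr s))"

text \<open>
  Boundedness is required explicitly because \<open>diameter\<close> is unspecified on unbounded sets.
  Sequences of covering sets include the finite covers, since members may be empty.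
\<close>

definition hausdorff_premeasure :: "real \<Rightarrow> real \<Rightarrow> 'a::metric_space set \<Rightarrow> ennreal" where
  "hausdorff_premeasure s d E =
     (INF U \<in> {U :: nat \<Rightarrow> 'a set.
         E \<subseteq> (\<Union>i. U i) \<and> (\<forall>i. bounded (U i) \<and> diameter (U i) \<le> d)}.
       \<Sum>i. hausdorff_gauge s (U i))"

definition hausdorff_measure :: "real \<Rightarrow> 'a::metric_space set \<Rightarrow> ennreal" where
  "hausdorff_measure s E = (SUP d \<in> {0<..}. hausdorff_premeasure s d E)"

definition hausdorff_dim :: "'a::metric_space set \<Rightarrow> ereal" where
  "hausdorff_dim E = Inf {ereal s | s. 0 \<le> s \<and> hausdorff_measure s E = 0}"

definition hausdorff_dim_measure :: "'a::metric_space measure \<Rightarrow> ereal" where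
  "hausdorff_dim_measure \<mu> = (INF E \<in> {E \<in> sets \<mu>. emeasure \<mu> E > 0}. hausdorff_dim E)"


section \<open>Ryll--Wojtaszczyk sequences\<close>

text \<open>
  \<open>holo_homogeneous j\<close> is the space \<open>H(j,0)\<close>: the condition concerns only the
  restriction of \<open>f\<close> to the unit sphere. The sum over multi-indices is finite by
  \<open>finite_multiindices\<close>.
\<close>

definition multiindices :: "nat \<Rightarrow> ('n::finite \<Rightarrow> nat) set" where
  "multiindices j = {\<alpha>. (\<Sum>i\<in>UNIV. \<alpha> i) = j}"

lemma finite_multiindices: "finite (multiindices j :: ('n::finite \<Rightarrow> nat) set)"
proof (rule finite_subset)
  show "multiindices j \<subseteq> (UNIV :: 'n set) \<rightarrow>\<^sub>E {..j}"
    using member_le_sum[of _ "UNIV :: 'n set"]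
    by (fastforce simp: multiindices_def PiE_def extensional_def)
  show "finite ((UNIV :: 'n set) \<rightarrow>\<^sub>E {..j})"
    by (intro finite_PiE) auto
qed

definition holo_homogeneous :: "nat \<Rightarrow> (complex ^ 'n \<Rightarrow> complex) set" where
  "holo_homogeneous j =
     {f. \<exists>c :: ('n \<Rightarrow> nat) \<Rightarrow> complex. \<forall>z \<in> sphere 0 1.
           f z = (\<Sum>\<alpha>\<in>multiindices j. c \<alpha> * (\<Prod>i\<in>UNIV. (z $ i) ^ \<alpha> i))}"

text \<open>
  Sequences are indexed by the positive integers; the value at index \<open>0\<close> is irrelevant throughout.
\<close>

definition RW_sequence :: "real \<Rightarrow> (nat \<Rightarrow> complex ^ 'n \<Rightarrow> complex) \<Rightarrow> bool" where
  "RW_sequence \<delta> R \<longleftrightarrow>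
     (\<forall>j\<ge>1. R j \<in> holo_homogeneous j \<and>
            esssup sphere_measure (\<lambda>z. ereal (norm (R j z))) = 1 \<and>
            sqrt (\<integral>z. (norm (R j z))\<^sup>2 \<partial>sphere_measure) \<ge> \<delta>)"


section \<open>Riesz triples and Riesz products\<close>

definition riesz_triple ::
  "(nat \<Rightarrow> complex ^ 'n \<Rightarrow> complex) \<Rightarrow> (nat \<Rightarrow> nat) \<Rightarrow> (nat \<Rightarrow> complex) \<Rightarrow> bool" where
  "riesz_triple R J a \<longleftrightarrow>
     (\<exists>\<delta>. 0 < \<delta> \<and> \<delta> < 1 \<and> RW_sequence \<delta> R) \<and>
     (\<forall>k\<ge>1. J k > 0 \<and> real (J (k + 1)) / real (J k) \<ge> 3) \<and>
     (\<forall>k\<ge>1. a k \<in> ball 0 1)"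

text \<open>
  For a Riesz triple each factor is real and positive on the sphere, being
  \<open>1 + Re (a\<^sub>k R\<^bsub>j\<^sub>k\<^esub>)\<close> with \<open>|a\<^sub>k R\<^bsub>j\<^sub>k\<^esub>| < 1\<close>, so taking the real part and passing to
  \<open>ennreal\<close> does not change the density.
\<close>

definition riesz_partial ::
  "(nat \<Rightarrow> complex ^ 'n \<Rightarrow> complex) \<Rightarrow> (nat \<Rightarrow> nat) \<Rightarrow> (nat \<Rightarrow> complex) \<Rightarrow> nat
     \<Rightarrow> (complex ^ 'n) measure" where
  "riesz_partial R J a N =
     density sphere_measure (\<lambda>z. ennreal (Re (\<Prod>k\<in>{1..N}.
       cnj (a k) * cnj (R (J k) z) / 2 + 1 + a k * R (J k) z / 2)))"

definition weak_star_limit ::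
  "(nat \<Rightarrow> 'a::euclidean_space measure) \<Rightarrow> 'a measure \<Rightarrow> bool" where
  "weak_star_limit \<nu> \<mu> \<longleftrightarrow>
     (\<forall>f :: 'a \<Rightarrow> complex. continuous_on (sphere 0 1) f \<longrightarrow>
        (\<lambda>N. \<integral>z. f z \<partial>\<nu> N) \<longlonglongrightarrow> (\<integral>z. f z \<partial>\<mu>))"

text \<open>
  \<open>riesz_product R J a \<mu>\<close> says that the Borel measure \<open>\<mu>\<close> on the sphere is \<open>\<Pi>(R,J,a)\<close>.
  By the Riesz representation theorem there is at most one such \<open>\<mu>\<close>.
\<close>

definition riesz_product ::
  "(nat \<Rightarrow> complex ^ 'n \<Rightarrow> complex) \<Rightarrow> (nat \<Rightarrow> nat) \<Rightarrow> (nat \<Rightarrow> complex)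
     \<Rightarrow> (complex ^ 'n) measure \<Rightarrow> bool" where
  "riesz_product R J a \<mu> \<longleftrightarrow>
     sets \<mu> = sets (restrict_space borel (sphere 0 1)) \<and> prob_space \<mu> \<and>
     weak_star_limit (riesz_partial R J a) \<mu>"

end

theory Submission
  imports Defs "HOL-Complex_Analysis.Cauchy_Integral_Formula" "HOL-Real_Asymp.Real_Asymp"
begin

text \<open>
  Write \<open>u\<^sub>k = a\<^sub>k R\<^bsub>j\<^sub>k\<^esub>\<close>, \<open>x\<^sub>k = Re u\<^sub>k\<close>, \<open>S\<^sub>N = x\<^sub>1 + \<dots> + x\<^sub>N\<close>. The partial densities are at most
  \<open>exp S\<^sub>N\<close>, which by Bernstein's inequality is comparable to a constant on balls of radius \<open>1/j\<^sub>N\<close>,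
  unlike the partial densities themselves, whose factors may come close to \<open>0\<close>. The remaining
  factors have mean \<open>1\<close> against any function whose frequencies with respect to the circle action
  \<open>z \<mapsto> e\<^sup>i\<^sup>t z\<close> are below \<open>j\<^bsub>N+1\<^esub>\<close>. Testing them with the indicator of a tube around the complex line of
  \<open>w\<close> times a Fejer kernel in the circle direction gives \<open>\<mu>(B(w, r)) \<le> C r\<^bsup>2n-1\<^esup> exp S\<^sub>N(w)\<close> for
  \<open>1/j\<^bsub>N+1\<^esub> \<le> 2r \<le> 1/j\<^sub>N\<close>.

  With \<open>y\<^sub>k = x\<^sub>k - |u\<^sub>k|\<^sup>2/2\<close> one has \<open>\<integral> (1 + c y\<^sub>1) \<cdots> (1 + c y\<^sub>N) d\<mu> = 1\<close>, so by Markov and Borel-Cantelli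
  \<open>S\<^sub>N \<le> (|a\<^sub>1|\<^sup>2 + \<dots> + |a\<^sub>N|\<^sup>2)/2 + o(N)\<close> almost everywhere, while \<open>N = O(log j\<^sub>N)\<close>. The
  mass distribution principle then bounds the dimension of any set of positive measure.
\<close>

section \<open>The circle action on the sphere\<close>

lemma norm_vector_smult: "norm (c *s z) = norm c * norm z"
  for c :: complex and z :: "complex ^ 'n"
proof -
  have "(norm (c *s z))\<^sup>2 = (norm c * norm z)\<^sup>2"
    by (simp add: norm_vec_def L2_set_def sum_nonneg power_mult_distrib norm_mult sum_distrib_left)
  then show ?thesis by (simp add: power2_eq_iff_nonneg)
qed

lemma orthogonal_transformation_cis:
  "orthogonal_transformation (\<lambda>z :: complex ^ 'n. cis t *s z)"
proof -
  have "linear (\<lambda>z :: complex ^ 'n. cis t *s z)"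
    by (rule linearI) (simp_all add: vec_eq_iff distrib_left)
  then show ?thesis
    by (simp add: orthogonal_transformation norm_vector_smult)
qed

lemma norm_cis_smult [simp]: "norm (cis t *s z) = norm z"
  for z :: "complex ^ 'n"
  by (simp add: norm_vector_smult)

interpretation sphere: prob_space sphere_measure
  by (rule prob_space_sphere_measure)

lemma continuous_on_sphere_measurable:
  fixes f :: "'a::euclidean_space \<Rightarrow> 'b::{second_countable_topology, t2_space}"
  assumes "continuous_on (sphere 0 1) f"
  shows "f \<in> borel_measurable sphere_measure"
proof -
  have "f \<in> borel_measurable (restrict_space borel (sphere 0 1))"
    using assms by (rule borel_measurable_continuous_on_restrict)
  then show ?thesis by (simp cong: measurable_cong_sets)
qed

lemma sphere_integrable:
  fixes f :: "'a::euclidean_space \<Rightarrow> 'b::{banach, second_countable_topology}"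
  assumes f: "continuous_on (sphere 0 1) f"
  shows "integrable sphere_measure f"
proof -
  have "compact (f ` sphere 0 1)"
    by (intro compact_continuous_image f compact_sphere)
  then obtain B where "\<forall>y\<in>f ` sphere 0 1. norm y \<le> B"
    using compact_imp_bounded bounded_iff by metis
  then show ?thesis
    using f by (intro sphere.integrable_const_bound[where B = B] continuous_on_sphere_measurable) auto
qed

lemma cis_smult_measurable:
  "(\<lambda>z :: complex ^ 'n. cis t *s z) \<in> sphere_measure \<rightarrow>\<^sub>M sphere_measure"
proof -
  have "continuous_on UNIV (\<lambda>z :: complex ^ 'n. cis t *s z)"
    using orthogonal_transformation_linear[OF orthogonal_transformation_cis[of t]]
    by (intro linear_continuous_on) (simp add: linear_conv_bounded_linear)
  then have [measurable]: "(\<lambda>z :: complex ^ 'n. cis t *s z) \<in> borel_measurable borel"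
    by (rule borel_measurable_continuous_onI)
  have "(\<lambda>z :: complex ^ 'n. cis t *s z)
      \<in> restrict_space borel (sphere 0 1) \<rightarrow>\<^sub>M restrict_space borel (sphere 0 1)"
    by (intro measurable_restrict_space2 measurable_restrict_space1)
       (auto simp: space_restrict_space)
  then show ?thesis by (simp cong: measurable_cong_sets)
qed

lemma integral_cis_smult:
  fixes f :: "complex ^ 'n \<Rightarrow> complex"
  assumes "f \<in> borel_measurable sphere_measure"
  shows "(\<integral>z. f (cis t *s z) \<partial>sphere_measure) = (\<integral>z. f z \<partial>sphere_measure)"
  using integral_distr[OF cis_smult_measurable[of t] assms]
  by (simp add: sphere_measure_rotation_invariant[OF orthogonal_transformation_cis])

section \<open>Spectra with respect to the circle action\<close>

text \<open>Measurability and boundedness are asked for instead of continuity, so that indicators of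
  invariant sets qualify. The degree is an integer because conjugation negates it.\<close>

definition homogeneous :: "int \<Rightarrow> (complex ^ 'n \<Rightarrow> complex) \<Rightarrow> bool" where
  "homogeneous d f \<longleftrightarrow> f \<in> borel_measurable sphere_measure \<and> bounded (f ` sphere 0 1) \<and>
     (\<forall>t. \<forall>z\<in>sphere 0 1. f (cis t *s z) = cis (of_int d * t) * f z)"

lemma homogeneous_integrable: "homogeneous d f \<Longrightarrow> integrable sphere_measure f"
proof -
  assume f: "homogeneous d f"
  then obtain B where "\<forall>x\<in>f ` sphere 0 1. norm x \<le> B"
    by (auto simp: homogeneous_def bounded_iff)
  then show ?thesis
    using f by (intro sphere.integrable_const_bound[where B = B]) (auto simp: homogeneous_def)
qed

text \<open>Rotation by the angle \<open>pi / d\<close> preserves the integral and turns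
  \<open>f\<close> into \<open>- f\<close>.\<close>

lemma homogeneous_integral_eq_0:
  assumes "homogeneous d f" "d \<noteq> 0"
  shows "(\<integral>z. f z \<partial>sphere_measure) = 0"
proof -
  let ?t = "pi / of_int d"
  have m: "f \<in> borel_measurable sphere_measure" using assms(1) by (simp add: homogeneous_def)
  have "(\<integral>z. f z \<partial>sphere_measure) = (\<integral>z. f (cis ?t *s z) \<partial>sphere_measure)"
    by (rule integral_cis_smult[OF m, symmetric])
  also have "\<dots> = (\<integral>z. - f z \<partial>sphere_measure)"
    using assms by (intro Bochner_Integration.integral_cong refl) (simp add: homogeneous_def)
  also have "\<dots> = - (\<integral>z. f z \<partial>sphere_measure)" by simp
  finally show ?thesis by simp
qed

lemma homogeneous_mult:
  assumes "homogeneous d f" "homogeneous e g"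
  shows "homogeneous (d + e) (\<lambda>z. f z * g z)"
proof -
  obtain B C where B: "\<forall>z\<in>sphere 0 1. norm (f z) \<le> B" and C: "\<forall>z\<in>sphere 0 1. norm (g z) \<le> C"
    using assms by (auto simp: homogeneous_def bounded_iff)
  have "norm (f z * g z) \<le> B * C" if "z \<in> sphere 0 1" for z
  proof -
    have "0 \<le> B" using B that norm_ge_zero[of "f z"] by (metis order_trans)
    then show ?thesis using B C that by (auto simp: norm_mult intro!: mult_mono)
  qed
  then have "bounded ((\<lambda>z. f z * g z) ` sphere 0 1)"
    unfolding bounded_iff by (intro exI[of _ "B * C"]) blast
  moreover have "(\<lambda>z. f z * g z) \<in> borel_measurable sphere_measure"
    using assms by (auto simp: homogeneous_def)
  ultimately show ?thesis
    using assms by (auto simp: homogeneous_def cis_mult[symmetric] distrib_right)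
qed

lemma homogeneous_cnj:
  assumes "homogeneous d f"
  shows "homogeneous (- d) (\<lambda>z. cnj (f z))"
proof -
  have "bounded ((\<lambda>z. cnj (f z)) ` sphere 0 1)"
    using assms by (auto simp: homogeneous_def bounded_iff)
  moreover have "cnj \<in> borel_measurable borel"
    by (intro borel_measurable_continuous_onI continuous_intros)
  then have "(\<lambda>z. cnj (f z)) \<in> borel_measurable sphere_measure"
    using assms measurable_compose[of f sphere_measure borel cnj] by (simp add: homogeneous_def)
  ultimately show ?thesis
    using assms by (auto simp: homogeneous_def cis_cnj)
qed

lemma homogeneous_const: "homogeneous 0 (\<lambda>z. c)"
  by (auto simp: homogeneous_def bounded_iff)

lemma homogeneous_cmult: "homogeneous d f \<Longrightarrow> homogeneous d (\<lambda>z. c * f z)"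
  using homogeneous_mult[OF homogeneous_const[of c], of d f] by simp

lemma homogeneous_power: "homogeneous d f \<Longrightarrow> homogeneous (int k * d) (\<lambda>z. f z ^ k)"
proof (induction k)
  case (Suc k)
  then show ?case
    using homogeneous_mult[of d f "int k * d" "\<lambda>z. f z ^ k"] by (simp add: distrib_right)
qed (simp add: homogeneous_const)

text \<open>Finite sums of homogeneous functions. \<open>D\<close> only has to contain the degrees
  that occur, so spectra of products can be estimated by sumsets.\<close>

inductive has_spectrum :: "int set \<Rightarrow> (complex ^ 'n \<Rightarrow> complex) \<Rightarrow> bool" for D where
  homogeneous: "homogeneous d f \<Longrightarrow> d \<in> D \<Longrightarrow> has_spectrum D f"
| add: "has_spectrum D f \<Longrightarrow> has_spectrum D g \<Longrightarrow> has_spectrum D (\<lambda>z. f z + g z)"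

lemma has_spectrum_mono: "has_spectrum D f \<Longrightarrow> D \<subseteq> E \<Longrightarrow> has_spectrum E f"
  by (induction rule: has_spectrum.induct) (auto intro: has_spectrum.intros)

lemma has_spectrum_integrable: "has_spectrum D f \<Longrightarrow> integrable sphere_measure f"
  by (induction rule: has_spectrum.induct) (auto intro: homogeneous_integrable)

lemma has_spectrum_integral_eq_0:
  "has_spectrum D f \<Longrightarrow> 0 \<notin> D \<Longrightarrow> (\<integral>z. f z \<partial>sphere_measure) = 0"
proof (induction rule: has_spectrum.induct)
  case (homogeneous d f)
  then show ?case by (metis homogeneous_integral_eq_0)
qed (simp add: has_spectrum_integrable)

lemma has_spectrum_mult:
  assumes "has_spectrum D f" "has_spectrum E g"
    and DE: "\<And>d e. d \<in> D \<Longrightarrow> e \<in> E \<Longrightarrow> d + e \<in> A"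
  shows "has_spectrum A (\<lambda>z. f z * g z)"
  using assms(1)
proof (induction rule: has_spectrum.induct)
  case f: (homogeneous d f)
  show ?case using assms(2)
  proof (induction rule: has_spectrum.induct)
    case (homogeneous e g)
    then show ?case using f DE by (blast intro: has_spectrum.homogeneous homogeneous_mult)
  next
    case (add g h)
    then show ?case using has_spectrum.add by (fastforce simp: distrib_left)
  qed
next
  case (add f h)
  then show ?case using has_spectrum.add by (fastforce simp: distrib_right)
qed

lemma has_spectrum_cmult: "has_spectrum D f \<Longrightarrow> has_spectrum D (\<lambda>z. c * f z)"
  by (rule has_spectrum_mult[OF has_spectrum.homogeneous[OF homogeneous_const, of "{0}"]]) auto

lemma has_spectrum_cnj: "has_spectrum D f \<Longrightarrow> has_spectrum (uminus ` D) (\<lambda>z. cnj (f z))"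
  by (induction rule: has_spectrum.induct)
     (auto intro: has_spectrum.intros homogeneous_cnj)

lemma has_spectrum_sum:
  assumes "finite I" "I \<noteq> {}" "\<And>i. i \<in> I \<Longrightarrow> has_spectrum D (f i)"
  shows "has_spectrum D (\<lambda>z. \<Sum>i\<in>I. f i z)"
  using assms by (induction rule: finite_ne_induct) (auto intro: has_spectrum.intros)

text \<open>Induction on \<open>M\<close>. If the product so far has frequencies below
  \<open>J (Suc M)\<close>, multiplying it by \<open>G (Suc M) z - 1\<close> gives frequencies
  \<open>d\<close> with \<open>0 < \<bar>d\<bar> < 3 * J (Suc M)\<close>. This correction integrates
  to 0 and stays below \<open>J (Suc (Suc M))\<close>. The range up to \<open>2 * J k\<close> leaves
  room for the squares in the tilted factors used later.\<close>

lemma integral_spectral_product: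
  fixes J :: "nat \<Rightarrow> nat"
  assumes J: "\<And>k. k > N \<Longrightarrow> k \<le> M \<Longrightarrow> 3 * J k \<le> J (Suc k)"
    and Q: "has_spectrum {d. \<bar>d\<bar> < int (J (Suc N))} Q"
    and G: "\<And>k. k > N \<Longrightarrow> k \<le> M \<Longrightarrow>
      has_spectrum {d. int (J k) \<le> \<bar>d\<bar> \<and> \<bar>d\<bar> \<le> 2 * int (J k)} (\<lambda>z. G k z - 1)"
    and "N \<le> M"
  shows "has_spectrum {d. \<bar>d\<bar> < int (J (Suc M))} (\<lambda>z. Q z * (\<Prod>k\<in>{N<..M}. G k z))"
    and "(\<integral>z. Q z * (\<Prod>k\<in>{N<..M}. G k z) \<partial>sphere_measure) = (\<integral>z. Q z \<partial>sphere_measure)"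
proof -
  let ?P = "\<lambda>M z. Q z * (\<Prod>k\<in>{N<..M}. G k z)"
  have "has_spectrum {d. \<bar>d\<bar> < int (J (Suc M))} (?P M) \<and>
    (\<integral>z. ?P M z \<partial>sphere_measure) = (\<integral>z. Q z \<partial>sphere_measure)"
    using \<open>N \<le> M\<close> J G
  proof (induction M rule: dec_induct)
    case base
    then show ?case using Q by simp
  next
    case (step M)
    have IH: "has_spectrum {d. \<bar>d\<bar> < int (J (Suc M))} (?P M)"
      "(\<integral>z. ?P M z \<partial>sphere_measure) = (\<integral>z. Q z \<partial>sphere_measure)"
      using step.IH step.prems by auto
    have "3 * J (Suc M) \<le> J (Suc (Suc M))"
      using step.hyps by (intro step.prems(1)) auto
    then have J: "3 * int (J (Suc M)) \<le> int (J (Suc (Suc M)))" by linarith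
    have G: "has_spectrum {d. int (J (Suc M)) \<le> \<bar>d\<bar> \<and> \<bar>d\<bar> \<le> 2 * int (J (Suc M))}
      (\<lambda>z. G (Suc M) z - 1)"
      using step.hyps by (intro step.prems(2)) auto
    have "{N<..Suc M} = insert (Suc M) {N<..M}" using step.hyps by auto
    then have eq: "?P (Suc M) = (\<lambda>z. ?P M z + ?P M z * (G (Suc M) z - 1))"
      by (auto simp: algebra_simps)
    have s: "has_spectrum {d. d \<noteq> 0 \<and> \<bar>d\<bar> < int (J (Suc (Suc M)))} (\<lambda>z. ?P M z * (G (Suc M) z - 1))"
      by (rule has_spectrum_mult[OF IH(1) G]) (use J in auto)
    have s': "has_spectrum {d. \<bar>d\<bar> < int (J (Suc (Suc M)))} (?P M)"
      by (rule has_spectrum_mono[OF IH(1)]) (use J in auto)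
    have "has_spectrum {d. \<bar>d\<bar> < int (J (Suc (Suc M)))} (?P (Suc M))"
      unfolding eq by (intro has_spectrum.add s' has_spectrum_mono[OF s]) auto
    moreover have "(\<integral>z. ?P (Suc M) z \<partial>sphere_measure) = (\<integral>z. Q z \<partial>sphere_measure)"
      unfolding eq
      by (subst Bochner_Integration.integral_add)
         (auto simp: has_spectrum_integrable[OF s] has_spectrum_integrable[OF s'] IH(2)
           has_spectrum_integral_eq_0[OF s])
    ultimately show ?case by blast
  qed
  then show "has_spectrum {d. \<bar>d\<bar> < int (J (Suc M))} (?P M)"
    "(\<integral>z. ?P M z \<partial>sphere_measure) = (\<integral>z. Q z \<partial>sphere_measure)" by auto
qed

section \<open>The mass distribution principle\<close>

text \<open>A cover of \<open>E\<close> by small sets yields a cover of \<open>A\<close> by balls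
  centred in \<open>A\<close>, whose total mass is at most \<open>C\<close> times the sum of the
  gauges. That sum is therefore bounded below by \<open>measure \<mu> A / C\<close>.\<close>

lemma mass_distribution_principle:
  fixes \<mu> :: "'a::euclidean_space measure"
  assumes fin: "finite_measure \<mu>" and sets: "sets \<mu> = sets (restrict_space borel S)"
    and A: "A \<in> sets \<mu>" "emeasure \<mu> A > 0" and AE: "A \<subseteq> E"
    and s: "0 \<le> s" "s < s'" and d: "0 < d" "d \<le> 1" and C: "0 < C"
    and ball: "\<And>x r. x \<in> A \<Longrightarrow> 0 < r \<Longrightarrow> r \<le> d \<Longrightarrow>
      emeasure \<mu> (cball x r \<inter> S) \<le> ennreal (C * r powr s')"
  shows "hausdorff_measure s E \<noteq> 0"
proof
  assume "hausdorff_measure s E = 0"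
  interpret finite_measure \<mu> by fact
  have AS: "A \<subseteq> S"
    using A(1) sets sets.sets_into_space[of A "restrict_space borel S"] by (simp add: space_restrict_space)
  have bS: "cball x r \<inter> S \<in> sets \<mu>" for x r
    by (auto simp: sets sets_restrict_space)
  have mA: "measure \<mu> A > 0"
    using A(2) by (simp add: emeasure_eq_measure)
  have "hausdorff_premeasure s d E \<le> hausdorff_measure s E"
    unfolding hausdorff_measure_def using d by (intro SUP_upper) auto
  then have "hausdorff_premeasure s d E < ennreal (measure \<mu> A / C)"
    using \<open>hausdorff_measure s E = 0\<close> mA C by simp
  then obtain U where U: "E \<subseteq> (\<Union>i. U i)" "\<And>i. bounded (U i)" "\<And>i. diameter (U i) \<le> d"
    and sum: "(\<Sum>i. hausdorff_gauge s (U i)) < ennreal (measure \<mu> A / C)"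
    unfolding hausdorff_premeasure_def INF_less_iff by auto
  \<comment> \<open>A covering set that meets \<open>A\<close> lies in the ball around any of its
    points with its diameter as radius. The centre is taken in \<open>A\<close>, where the mass
    bound is available, and sets missing \<open>A\<close> are dropped.\<close>
  define V where
    "V i = (if U i \<inter> A = {} then {} else cball (SOME x. x \<in> U i \<inter> A) (diameter (U i)) \<inter> S)" for i
  have mV: "V i \<in> sets \<mu>" for i by (simp add: V_def bS)
  have V: "emeasure \<mu> (V i) \<le> ennreal C * hausdorff_gauge s (U i)" for i
  proof (cases "U i \<inter> A = {}")
    case False
    define x where "x = (SOME x. x \<in> U i \<inter> A)"
    have x: "x \<in> U i" "x \<in> A"
      using someI_ex[of "\<lambda>x. x \<in> U i \<inter> A"] False unfolding x_def by blast+
    have Vi: "V i = cball x (diameter (U i)) \<inter> S" using False by (simp add: V_def x_def)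
    have "diameter (U i) \<ge> 0" using U(2) by (rule diameter_ge_0)
    then consider "diameter (U i) > 0" | "diameter (U i) = 0" by linarith
    then show ?thesis
    proof cases
      case 1
      have "emeasure \<mu> (V i) \<le> ennreal (C * diameter (U i) powr s')"
        unfolding Vi by (rule ball[OF x(2) 1 U(3)])
      also have "\<dots> \<le> ennreal (C * diameter (U i) powr s)"
        using C s U(3)[of i] d 1 by (intro ennreal_leI mult_left_mono powr_mono') auto
      also have "\<dots> = ennreal C * hausdorff_gauge s (U i)"
        using x 1 C by (auto simp: hausdorff_gauge_def ennreal_mult)
      finally show ?thesis .
    next
      case 2
      \<comment> \<open>A one-point set has gauge 1 for \<open>s = 0\<close> and 0 otherwise. Both
        cases follow once \<open>V i\<close> is null, which comes from shrinking the radius to 0;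
        \<open>s < s'\<close> ensures that \<open>s'\<close> is positive.\<close>
      have "((\<lambda>r. ennreal (C * r powr s')) \<longlongrightarrow> ennreal (C * 0 powr s')) (at_right 0)"
        using s by (intro tendsto_intros tendsto_ennrealI tendsto_powr') (auto intro: eventually_mono[OF eventually_at_right_less])
      moreover have "\<forall>\<^sub>F r in at_right 0. emeasure \<mu> (V i) \<le> ennreal (C * r powr s')"
      proof (rule eventually_at_rightI[OF _ d(1)])
        fix r assume r: "r \<in> {0<..<d}"
        have "emeasure \<mu> (V i) \<le> emeasure \<mu> (cball x r \<inter> S)"
          unfolding Vi using r 2 by (intro emeasure_mono bS) auto
        also have "\<dots> \<le> ennreal (C * r powr s')" using r by (intro ball x) auto
        finally show "emeasure \<mu> (V i) \<le> ennreal (C * r powr s')" .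
      qed
      ultimately have "emeasure \<mu> (V i) \<le> ennreal (C * 0 powr s')"
        by (rule tendsto_lowerbound) simp
      then show ?thesis by simp
    qed
  qed (simp add: V_def)
  have "A \<subseteq> (\<Union>i. V i)"
  proof
    fix y assume y: "y \<in> A"
    then obtain i where i: "y \<in> U i" using AE U(1) by auto
    then have "(SOME x. x \<in> U i \<inter> A) \<in> U i \<inter> A"
      using y by (intro someI[of "\<lambda>x. x \<in> U i \<inter> A" y]) blast
    then have "y \<in> V i"
      using y i AS U(2)[of i] diameter_bounded_bound[of "U i" _ y] by (auto simp: V_def)
    then show "y \<in> (\<Union>i. V i)" by blast
  qed
  then have "emeasure \<mu> A \<le> emeasure \<mu> (\<Union>i. V i)"
    using mV by (intro emeasure_mono) auto
  also have "\<dots> \<le> (\<Sum>i. emeasure \<mu> (V i))"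
    using mV by (intro emeasure_subadditive_countably) auto
  also have "\<dots> \<le> (\<Sum>i. ennreal C * hausdorff_gauge s (U i))"
    by (intro suminf_le V summableI)
  also have "\<dots> = ennreal C * (\<Sum>i. hausdorff_gauge s (U i))" by simp
  finally have le: "ennreal (measure \<mu> A) \<le> ennreal C * (\<Sum>i. hausdorff_gauge s (U i))"
    by (simp add: emeasure_eq_measure)
  obtain q where q: "0 \<le> q" "(\<Sum>i. hausdorff_gauge s (U i)) = ennreal q"
    using sum by (metis ennreal_cases order.strict_trans ennreal_less_top less_irrefl)
  then have "q < measure \<mu> A / C" using sum C mA by (simp add: ennreal_less_iff)
  moreover have "measure \<mu> A \<le> C * q"
    using le q C by (simp add: ennreal_mult[symmetric])
  ultimately show False using C by (simp add: field_simps)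
qed

section \<open>Tubes around complex lines\<close>

text \<open>The Hermitian inner product, linear in the first argument, so that it has degree 1 in
  \<open>z\<close> under the circle action.\<close>

definition hdot :: "complex ^ 'n \<Rightarrow> complex ^ 'n \<Rightarrow> complex" where
  "hdot z w = (\<Sum>i\<in>UNIV. z $ i * cnj (w $ i))"

lemma hdot_smult_left: "hdot (c *s z) w = c * hdot z w"
  by (simp add: hdot_def sum_distrib_left mult_ac)

lemma hdot_diff_left: "hdot (x - y) w = hdot x w - hdot y w"
  by (simp add: hdot_def sum_subtractf left_diff_distrib)

lemma hdot_cnj: "hdot w z = cnj (hdot z w)"
  by (simp add: hdot_def mult_ac)

lemma hdot_self: "hdot z z = of_real ((norm z)\<^sup>2)"
  by (simp add: hdot_def norm_vec_def L2_set_def sum_nonneg complex_norm_square[symmetric])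

lemma continuous_on_hdot [continuous_intros]:
  "continuous_on S f \<Longrightarrow> continuous_on S (\<lambda>z. hdot (f z) w)"
  unfolding hdot_def by (intro continuous_intros)

text \<open>Pythagoras: \<open>z - hdot z w *s w\<close> is orthogonal to \<open>w\<close>. The
  choice \<open>c = hdot z w\<close> gives the Cauchy-Schwarz inequality; comparing it with
  \<open>c = 1\<close> puts balls around \<open>w\<close> into tubes.\<close>

lemma norm_diff_smult_unit:
  fixes z w :: "complex ^ 'n"
  assumes "norm w = 1"
  shows "(norm (z - c *s w))\<^sup>2 = (norm z)\<^sup>2 - (norm (hdot z w))\<^sup>2 + (norm (c - hdot z w))\<^sup>2"
proof -
  have ww: "hdot w w = 1" using assms by (simp add: hdot_self)
  have "hdot (z - c *s w) (z - c *s w) =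
    hdot z z - hdot z w * cnj (hdot z w) + (c - hdot z w) * cnj (c - hdot z w)"
    unfolding hdot_diff_left hdot_smult_left
      hdot_cnj[of z "z - c *s w"] hdot_cnj[of w "z - c *s w"]
    by (simp add: hdot_diff_left hdot_smult_left ww hdot_cnj[of w z] hdot_cnj[of z z, symmetric]
      algebra_simps)
  then have "complex_of_real ((norm (z - c *s w))\<^sup>2) =
    of_real ((norm z)\<^sup>2 - (norm (hdot z w))\<^sup>2 + (norm (c - hdot z w))\<^sup>2)"
    unfolding hdot_self complex_norm_square[symmetric] by simp
  then show ?thesis by (simp only: of_real_eq_iff)
qed

lemma norm_hdot_le:
  assumes "norm w = 1"
  shows "norm (hdot z w) \<le> norm z"
proof -
  have "0 \<le> (norm z)\<^sup>2 - (norm (hdot z w))\<^sup>2"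
    using norm_diff_smult_unit[OF assms, of z "hdot z w"]
    by (metis add_0_right cancel_comm_monoid_add_class.diff_cancel norm_zero power_zero_numeral
      zero_le_power2)
  then show ?thesis by (simp add: power2_le_iff_abs_le)
qed

text \<open>The closed neighbourhood of radius \<open>r\<close> of the complex line through
  \<open>w\<close>. It is invariant under the circle action, so its indicator has degree 0.\<close>

definition tube :: "complex ^ 'n \<Rightarrow> real \<Rightarrow> (complex ^ 'n) set" where
  "tube w r = {z. norm (z - hdot z w *s w) \<le> r}"

lemma dist_imp_in_tube:
  assumes "norm w = 1" "dist z w \<le> r"
  shows "z \<in> tube w r"
proof -
  have "(norm (z - hdot z w *s w))\<^sup>2 \<le> (norm (z - 1 *s w))\<^sup>2"
    unfolding norm_diff_smult_unit[OF assms(1)] by simp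
  then have "norm (z - hdot z w *s w) \<le> norm (z - w)" by (simp add: power2_le_iff_abs_le)
  then show ?thesis using assms(2) by (simp add: tube_def dist_norm)
qed

lemma continuous_on_smult [continuous_intros]:
  "continuous_on S f \<Longrightarrow> continuous_on S (\<lambda>z. f z *s (w :: complex ^ 'n))"
  unfolding vector_scalar_mult_def by (intro continuous_intros)

lemma smult_of_real: "of_real c *s z = c *\<^sub>R z"
  for z :: "complex ^ 'n"
  by (simp add: vec_eq_iff scaleR_conv_of_real[where 'a = complex])

lemma closed_tube: "closed (tube w r)"
proof -
  have "tube w r = (\<lambda>z. norm (z - hdot z w *s w)) -` {..r}"
    by (auto simp: tube_def)
  also have "closed \<dots>"
    by (intro continuous_closed_vimage continuous_on_imp_continuous_within)
       (auto intro!: continuous_intros simp: continuous_on_eq_continuous_at[symmetric])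
  finally show ?thesis .
qed

lemma tube_cis: "cis t *s z \<in> tube w r \<longleftrightarrow> z \<in> tube w r"
proof -
  have "cis t *s z - hdot (cis t *s z) w *s w = cis t *s (z - hdot z w *s w)"
    by (simp add: hdot_smult_left vec_eq_iff algebra_simps)
  then show ?thesis by (simp only: tube_def mem_Collect_eq norm_cis_smult)
qed

text \<open>Rounding both coordinates of \<open>hdot x w\<close> down to multiples of
  \<open>r\<close> moves the projection of \<open>x\<close> by at most \<open>2 * r\<close>, and
  \<open>x\<close> is within \<open>r\<close> of its projection.\<close>

lemma tube_cover:
  assumes w: "norm w = 1" and r: "0 < r" "r \<le> 1"
  shows "cball 0 1 \<inter> tube w r \<subseteq>
    (\<Union>(p, q)\<in>{- \<lceil>1 / r\<rceil>..\<lceil>1 / r\<rceil>} \<times> {- \<lceil>1 / r\<rceil>..\<lceil>1 / r\<rceil>}.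
       cball (of_real r * Complex (of_int p) (of_int q) *s w) (3 * r))"
proof
  fix x assume x: "x \<in> cball 0 1 \<inter> tube w r"
  let ?h = "hdot x w"
  define p where "p = \<lfloor>Re ?h / r\<rfloor>"
  define q where "q = \<lfloor>Im ?h / r\<rfloor>"
  let ?g = "of_real r * Complex (of_int p) (of_int q)"
  have h: "norm ?h \<le> 1" using norm_hdot_le[OF w, of x] x by auto
  have mem: "\<lfloor>t / r\<rfloor> \<in> {- \<lceil>1 / r\<rceil>..\<lceil>1 / r\<rceil>}" if "\<bar>t\<bar> \<le> 1" for t
  proof -
    have "- 1 / r \<le> t / r" "t / r \<le> 1 / r"
      using that r by (auto intro!: divide_right_mono simp del: divide_minus_left)
    then have "- \<lceil>1 / r\<rceil> \<le> \<lfloor>t / r\<rfloor>" "\<lfloor>t / r\<rfloor> \<le> \<lceil>1 / r\<rceil>"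
      by (simp_all add: le_floor_iff floor_le_iff) linarith+
    then show ?thesis by simp
  qed
  have frac: "\<bar>t - r * of_int \<lfloor>t / r\<rfloor>\<bar> \<le> r" for t
  proof -
    have "t / r - 1 \<le> of_int \<lfloor>t / r\<rfloor>" "of_int \<lfloor>t / r\<rfloor> \<le> t / r" by linarith+
    then have "r * (t / r - 1) \<le> r * of_int \<lfloor>t / r\<rfloor>" "r * of_int \<lfloor>t / r\<rfloor> \<le> r * (t / r)"
      using r by (intro mult_left_mono; simp)+
    then have "t - r \<le> r * of_int \<lfloor>t / r\<rfloor>" "r * of_int \<lfloor>t / r\<rfloor> \<le> t"
      using r by (simp_all add: right_diff_distrib)
    then show ?thesis using r by (simp add: abs_if)
  qed
  have pq: "p \<in> {- \<lceil>1 / r\<rceil>..\<lceil>1 / r\<rceil>}" "q \<in> {- \<lceil>1 / r\<rceil>..\<lceil>1 / r\<rceil>}"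
    using h abs_Re_le_cmod[of ?h] abs_Im_le_cmod[of ?h] by (auto simp only: p_def q_def intro!: mem)
  have "norm (?h - ?g) \<le> \<bar>Re (?h - ?g)\<bar> + \<bar>Im (?h - ?g)\<bar>" by (rule cmod_le)
  also have "\<dots> \<le> r + r"
    using frac[of "Re ?h"] frac[of "Im ?h"] by (intro add_mono) (auto simp: p_def q_def)
  finally have g: "norm (?h - ?g) \<le> 2 * r" by simp
  have "norm (x - ?g *s w) = norm ((x - ?h *s w) + (?h - ?g) *s w)"
    by (simp add: vec_eq_iff algebra_simps)
  also have "\<dots> \<le> r + 2 * r"
  proof (intro norm_triangle_le add_mono)
    show "norm (x - ?h *s w) \<le> r" using x by (simp add: tube_def)
    show "norm ((?h - ?g) *s w) \<le> 2 * r" using g w by (simp only: norm_vector_smult mult_1_right)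
  qed
  finally have "dist (?g *s w) x \<le> 3 * r" by (simp add: dist_norm norm_minus_commute)
  then show "x \<in> (\<Union>(p, q)\<in>{- \<lceil>1 / r\<rceil>..\<lceil>1 / r\<rceil>} \<times> {- \<lceil>1 / r\<rceil>..\<lceil>1 / r\<rceil>}.
       cball (of_real r * Complex (of_int p) (of_int q) *s w) (3 * r))"
    using pq by (intro UN_I[of "(p, q)"]) simp_all
qed

text \<open>Since \<open>1 \<le> 1 / r\<close>, each coordinate takes at most \<open>5 / r\<close>
  grid values. Thus at most \<open>25 / r^2\<close> balls of radius \<open>3 * r\<close> in real
  dimension \<open>2 * CARD('n)\<close> are used, which lowers the exponent by 2.\<close>

lemma emeasure_tube_cball_le:
  fixes w :: "complex ^ 'n"
  assumes w: "norm w = 1" and r: "0 < r" "r \<le> 1"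
  shows "emeasure lborel (cball 0 1 \<inter> tube w r) \<le>
    ennreal (25 * unit_ball_vol (2 * real CARD('n)) * 3 ^ (2 * CARD('n)) * r ^ (2 * CARD('n) - 2))"
proof -
  define I where "I = {- \<lceil>1 / r\<rceil>..\<lceil>1 / r\<rceil>} \<times> {- \<lceil>1 / r\<rceil>..\<lceil>1 / r\<rceil>}"
  let ?v = "unit_ball_vol (2 * real CARD('n)) * (3 * r) ^ (2 * CARD('n))"
  define B where
    "B = (\<lambda>pq. cball ((of_real r * Complex (of_int (fst pq)) (of_int (snd pq))) *s w) (3 * r))"
  have fin: "finite I" by (simp add: I_def)
  have 1: "1 \<le> 1 / r" using r by simp
  then have "0 \<le> \<lceil>1 / r\<rceil>" by linarith
  then have "real (card {- \<lceil>1 / r\<rceil>..\<lceil>1 / r\<rceil>}) = 2 * of_int \<lceil>1 / r\<rceil> + 1" by simp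
  also have "\<dots> \<le> 5 * (1 / r)" using 1 by linarith
  finally have "real (card {- \<lceil>1 / r\<rceil>..\<lceil>1 / r\<rceil>}) \<le> 5 / r" by simp
  then have card: "real (card I) \<le> 5 / r * (5 / r)"
    unfolding I_def card_cartesian_product of_nat_mult by (intro mult_mono) (use r in auto)
  have "emeasure lborel (cball 0 1 \<inter> tube w r) \<le> emeasure lborel (\<Union>pq\<in>I. B pq)"
  proof (rule emeasure_mono)
    show "cball 0 1 \<inter> tube w r \<subseteq> (\<Union>pq\<in>I. B pq)"
      using tube_cover[OF assms] by (simp add: I_def B_def case_prod_beta)
    show "(\<Union>pq\<in>I. B pq) \<in> sets lborel" using fin by (auto simp: B_def)
  qed
  also have "\<dots> \<le> (\<Sum>pq\<in>I. emeasure lborel (B pq))"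
    using fin by (intro emeasure_subadditive_finite) (auto simp: B_def)
  also have "\<dots> = (\<Sum>pq\<in>I. ennreal ?v)"
    using r by (intro sum.cong refl) (simp add: B_def emeasure_cball mult_ac)
  also have "\<dots> = ennreal (real (card I) * ?v)"
    using r by (simp add: ennreal_mult ennreal_of_nat_eq_real_of_nat)
  also have "\<dots> \<le> ennreal (5 / r * (5 / r) * ?v)"
    using r by (intro ennreal_leI mult_right_mono card) auto
  also have "5 / r * (5 / r) * ?v =
    25 * unit_ball_vol (2 * real CARD('n)) * 3 ^ (2 * CARD('n)) * r ^ (2 * CARD('n) - 2)"
  proof -
    have "0 < CARD('n)" by simp
    then have "2 * CARD('n) = Suc (Suc (2 * CARD('n) - 2))" by linarith
    then have "r ^ (2 * CARD('n)) = r * (r * r ^ (2 * CARD('n) - 2))"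
      by (metis power_Suc)
    then show ?thesis using r by (simp add: power_mult_distrib field_simps)
  qed
  finally show ?thesis .
qed

lemma sphere_in_sets_sphere_measure:
  "A \<in> sets borel \<Longrightarrow> A \<inter> sphere 0 1 \<in> sets sphere_measure"
  by (auto simp: sets_restrict_space)

text \<open>\<open>sphere_measure\<close> is the normalized volume of the cone over a set. Scaling
  by a factor below 1 keeps points inside the tube, so the cone lies in the part of the tube in the
  unit ball.\<close>

lemma measure_sphere_tube_le:
  obtains C where "C > 0"
    "\<And>w r. norm w = 1 \<Longrightarrow> 0 < r \<Longrightarrow> r \<le> 1 \<Longrightarrow>
      measure sphere_measure (tube w r \<inter> sphere 0 1 :: (complex ^ 'n) set)
        \<le> C * r ^ (2 * CARD('n) - 2)"
proof -
  let ?K = "25 * unit_ball_vol (2 * real CARD('n)) * 3 ^ (2 * CARD('n))"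
  let ?V = "emeasure lborel (ball 0 1 - {0 :: complex ^ 'n})"
  define V where "V = enn2real ?V"
  have "0 < ?V" "?V < top"
    using emeasure_punctured_ball[where 'a = "complex ^ 'n"]
    by (simp_all only: less_top infinity_ennreal_def zero_less_iff_neq_zero not_False_eq_True)
  then have V: "?V = ennreal V" "V > 0"
    unfolding V_def by (simp_all only: ennreal_enn2real enn2real_positive_iff)
  show ?thesis
  proof
    show "?K / V > 0" using V by simp
    fix w :: "complex ^ 'n" and r :: real
    assume w: "norm w = 1" and r: "0 < r" "r \<le> 1"
    have "emeasure sphere_measure (tube w r \<inter> sphere 0 1) =
      emeasure lborel {x \<in> ball 0 1 - {0}. sgn x \<in> tube w r \<inter> sphere 0 1} / ?V"
      using sphere_in_sets_sphere_measure[OF borel_closed[OF closed_tube]]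
      by (intro emeasure_sphere_measure) simp
    also have "\<dots> \<le> emeasure lborel (cball 0 1 \<inter> tube w r) / ?V"
    proof (intro divide_right_mono_ennreal emeasure_mono)
      show "{x \<in> ball 0 1 - {0}. sgn x \<in> tube w r \<inter> sphere 0 1} \<subseteq> cball 0 1 \<inter> tube w r"
      proof
        fix x assume "x \<in> {x \<in> ball 0 1 - {0}. sgn x \<in> tube w r \<inter> sphere 0 1}"
        then have x: "norm x < 1" "x \<noteq> 0" "norm (sgn x - hdot (sgn x) w *s w) \<le> r"
          by (auto simp: tube_def)
        have eq: "x = of_real (norm x) *s sgn x"
          using x by (simp add: smult_of_real sgn_div_norm)
        have "x - hdot x w *s w = of_real (norm x) *s (sgn x - hdot (sgn x) w *s w)"
          by (subst (1 2) eq) (simp add: hdot_smult_left vector_ssub_ldistrib vector_smult_assoc)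
        then have "norm (x - hdot x w *s w) \<le> 1 * r"
          using x mult_mono[of "norm x" 1 "norm (sgn x - hdot (sgn x) w *s w)" r]
          by (simp only: norm_vector_smult) simp
        then show "x \<in> cball 0 1 \<inter> tube w r" using x by (simp add: tube_def)
      qed
    qed (auto simp: closed_tube borel_closed)
    also have "\<dots> \<le> ennreal (?K * r ^ (2 * CARD('n) - 2)) / ennreal V"
      using emeasure_tube_cball_le[OF w r] by (simp add: V divide_right_mono_ennreal)
    also have "\<dots> = ennreal (?K / V * r ^ (2 * CARD('n) - 2))"
      using V r by (subst divide_ennreal) auto
    finally show "measure sphere_measure (tube w r \<inter> sphere 0 1) \<le> ?K / V * r ^ (2 * CARD('n) - 2)"
      unfolding measure_def using V r by (intro enn2real_leI) auto
  qed
qed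

text \<open>If the bound failed at one point, the cone over the set where \<open>f\<close> exceeds
  \<open>c\<close> would be open, nonempty and Lebesgue null. This turns essential bounds into
  pointwise ones.\<close>

lemma sphere_measure_AE_le_imp:
  fixes f :: "'a::euclidean_space \<Rightarrow> real"
  assumes f: "continuous_on (sphere 0 1) f" and AE: "AE z in sphere_measure. f z \<le> c"
    and z: "z \<in> sphere 0 1"
  shows "f z \<le> c"
proof (rule ccontr)
  assume "\<not> f z \<le> c"
  let ?A = "{z \<in> sphere 0 1. f z > c}"
  let ?U = "{x \<in> ball 0 1 - {0}. sgn x \<in> ?A}"
  have m: "?A \<in> sets (sphere_measure :: 'a measure)"
    using measurable_sets[OF continuous_on_sphere_measurable[OF f], of "{c<..}"]
    by (simp add: vimage_def Int_def conj_commute)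
  have "emeasure sphere_measure ?A = 0"
    using AE m by (subst (asm) AE_iff_measurable[of ?A]) auto
  moreover have "emeasure sphere_measure ?A = emeasure lborel ?U / emeasure lborel (ball 0 1 - {0 :: 'a})"
    using m by (intro emeasure_sphere_measure) simp
  ultimately have U0: "emeasure lborel ?U = 0"
    using emeasure_punctured_ball(2)[where 'a = 'a] by simp
  have "continuous_on (ball 0 1 - {0 :: 'a}) (\<lambda>x. f (sgn x))"
  proof (rule continuous_on_compose2[OF f])
    show "continuous_on (ball 0 1 - {0 :: 'a}) sgn"
      unfolding sgn_div_norm by (auto intro!: continuous_intros)
  qed (auto simp: norm_sgn split: if_splits)
  then have "open ((ball 0 1 - {0}) \<inter> (\<lambda>x. f (sgn x)) -` {c<..})"
    by (intro continuous_open_preimage) auto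
  moreover have "(ball 0 1 - {0}) \<inter> (\<lambda>x. f (sgn x)) -` {c<..} = ?U"
    by (auto simp: norm_sgn)
  ultimately have U: "open ?U" by simp
  then have "?U \<in> null_sets lborel"
    using U0 by (intro null_setsI) (simp_all only: borel_open sets_lborel)
  then have "negligible ?U"
    unfolding negligible_iff_null_sets by (rule null_sets_completionI)
  moreover have "z /\<^sub>R 2 \<in> ?U"
    using z \<open>\<not> f z \<le> c\<close> by (auto simp: sgn_div_norm)
  ultimately show False using open_not_negligible[OF U] by blast
qed

section \<open>A Bernstein estimate for homogeneous polynomials\<close>

text \<open>The polynomial on the whole space. \<open>holo_homogeneous\<close> fixes values on the
  sphere only, while the derivative estimate below uses points off the sphere.\<close>

definition form :: "(('n::finite \<Rightarrow> nat) \<Rightarrow> complex) \<Rightarrow> nat \<Rightarrow> complex ^ 'n \<Rightarrow> complex" where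
  "form c j z = (\<Sum>\<alpha>\<in>multiindices j. c \<alpha> * (\<Prod>i\<in>UNIV. (z $ i) ^ \<alpha> i))"

lemma form_smult:
  fixes z :: "complex ^ 'n"
  shows "form c j (t *s z) = t ^ j * form c j z"
proof -
  have "(\<Prod>i\<in>UNIV. (t * z $ i) ^ \<alpha> i) = t ^ j * (\<Prod>i\<in>UNIV. (z $ i) ^ \<alpha> i)"
    if "\<alpha> \<in> multiindices j" for \<alpha> :: "'n \<Rightarrow> nat"
    using that by (simp add: multiindices_def power_mult_distrib prod.distrib power_sum[symmetric])
  then show ?thesis
    by (simp add: form_def sum_distrib_left algebra_simps)
qed

lemma continuous_on_form: "continuous_on A (form c j)"
  unfolding form_def by (intro continuous_intros)

lemma norm_form_le:
  assumes p1: "\<And>z. norm z = 1 \<Longrightarrow> norm (form c j z) \<le> 1" and "j \<ge> 1"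
  shows "norm (form c j z) \<le> norm z ^ j"
proof (cases "z = 0")
  case True
  then have "form c j z = 0 ^ j * form c j z" using form_smult[of c j 0 z] by simp
  then show ?thesis using \<open>j \<ge> 1\<close> by (simp add: power_0_left)
next
  case False
  have "of_real (norm z) *s sgn z = z"
    using False by (simp add: smult_of_real sgn_div_norm)
  then have "norm (form c j z) = norm z ^ j * norm (form c j (sgn z))"
    using form_smult[of c j "of_real (norm z)" "sgn z"] by (simp add: norm_mult norm_power)
  also have "\<dots> \<le> norm z ^ j * 1"
    using False by (intro mult_left_mono p1) (auto simp: norm_sgn)
  finally show ?thesis by simp
qed

text \<open>Cauchy's estimate on the complex line through \<open>w\<close> and \<open>z\<close>. The
  radius \<open>r\<close> moves a point by \<open>1 / j\<close>, so on the circle the polynomial is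
  at most \<open>(1 + 1 / j) ^ j \<le> exp 1 \<le> 3\<close>, and the derivative is at most
  \<open>3 / r\<close>.\<close>

lemma form_lipschitz:
  assumes p1: "\<And>z. norm z = 1 \<Longrightarrow> norm (form c j z) \<le> 1" and j: "j \<ge> 1"
    and z: "norm z = 1" and w: "norm w = 1"
  shows "norm (form c j z - form c j w) \<le> 3 * j * norm (z - w)"
proof (cases "z = w")
  case False
  define v where "v = z - w"
  define f where "f t = form c j (w + t *s v)" for t
  define r where "r = 1 / (j * norm v)"
  have v: "norm v > 0" using False by (simp add: v_def)
  have r: "r > 0" using v j by (simp add: r_def)
  have hol: "f holomorphic_on A" for A
    unfolding f_def form_def by (simp, intro holomorphic_intros)
  have seg: "norm (w + t *s v) \<le> 1" if "t \<in> closed_segment 0 1" for t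
  proof -
    have "\<exists>u. 0 \<le> u \<and> u \<le> 1 \<and> t = (1 - u) *\<^sub>R 0 + u *\<^sub>R 1"
      using that by (simp only: in_segment)
    then obtain u where u: "0 \<le> u" "u \<le> 1" and t: "t = of_real u"
      by (auto simp: scaleR_conv_of_real)
    have "w + t *s v = of_real (1 - u) *s w + of_real u *s z"
      by (simp add: t v_def vec_eq_iff algebra_simps)
    also have "norm \<dots> \<le> (1 - u) + u"
      using u z w by (intro norm_triangle_le) (simp only: norm_vector_smult norm_of_real, simp)
    finally show ?thesis by simp
  qed
  have "norm (f 1 - f 0) \<le> (3 * j * norm v) * norm (1 - 0 :: complex)"
  proof (rule field_differentiable_bound[of "closed_segment 0 1" f "deriv f"])
    fix t :: complex assume t: "t \<in> closed_segment 0 1"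
    have "norm ((deriv ^^ 1) f t) \<le> fact 1 * 3 / r ^ 1"
    proof (rule Cauchy_inequality[OF hol _ r])
      show "continuous_on (cball t r) f"
        using hol by (rule holomorphic_on_imp_continuous_on)
      fix x assume x: "norm (t - x) = r"
      have "norm ((x - t) *s v) = r * norm v"
        using x by (simp only: norm_vector_smult norm_minus_commute[of t x])
      moreover have "w + x *s v = (w + t *s v) + (x - t) *s v"
        by (simp add: vec_eq_iff algebra_simps)
      then have "norm (w + x *s v) \<le> norm (w + t *s v) + norm ((x - t) *s v)"
        by (simp only: norm_triangle_ineq)
      ultimately have "norm (w + x *s v) \<le> 1 + r * norm v"
        using seg[OF t] by linarith
      also have "\<dots> = 1 + 1 / j" using v by (simp add: r_def)
      finally have "norm (w + x *s v) \<le> 1 + 1 / j" .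
      then have "norm (w + x *s v) \<le> exp (1 / j)"
        using exp_ge_add_one_self[of "1 / j"] by linarith
      then have "norm (w + x *s v) ^ j \<le> exp (1 / j) ^ j" by (intro power_mono) auto
      also have "\<dots> = exp 1" using j by (simp add: exp_of_nat_mult[symmetric])
      also have "\<dots> \<le> 3" using exp_le by simp
      finally show "norm (f x) \<le> 3"
        using norm_form_le[OF p1 j, of "w + x *s v"] by (simp add: f_def)
    qed
    then show "norm (deriv f t) \<le> 3 * j * norm v" by (simp add: r_def)
    show "(f has_field_derivative deriv f t) (at t within closed_segment 0 1)"
      using holomorphic_derivI[OF hol[of UNIV]] by simp
  qed auto
  then show ?thesis by (simp add: f_def v_def)
qed simp

lemma
  assumes "RW_sequence \<delta> R" "j \<ge> 1"
  shows RW_sequence_continuous: "continuous_on (sphere 0 1) (R j)"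
    and RW_sequence_norm_le: "\<And>z. norm z = 1 \<Longrightarrow> norm (R j z) \<le> 1"
    and RW_sequence_lipschitz: "\<And>z w. norm z = 1 \<Longrightarrow> norm w = 1 \<Longrightarrow>
      norm (R j z - R j w) \<le> 3 * real j * norm (z - w)"
    and RW_sequence_homogeneous: "homogeneous (int j) (R j)"
proof -
  have R: "R j \<in> holo_homogeneous j" "esssup sphere_measure (\<lambda>z. ereal (norm (R j z))) = 1"
    using assms by (auto simp: RW_sequence_def)
  then obtain c :: "('a \<Rightarrow> nat) \<Rightarrow> complex" where
    c: "\<And>z. norm z = 1 \<Longrightarrow> R j z = form c j z"
    by (auto simp: holo_homogeneous_def form_def)
  show cont: "continuous_on (sphere 0 1) (R j)"
    using continuous_on_form[of "sphere 0 1" c j] by (rule continuous_on_eq) (simp add: c)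
  have "AE z in sphere_measure. norm (R j z) \<le> 1"
    using esssup_AE[where M = sphere_measure and f = "\<lambda>z. ereal (norm (R j z))"]
    by (simp add: R(2))
  then show le: "norm (R j z) \<le> 1" if "norm z = 1" for z
    using that by (intro sphere_measure_AE_le_imp[of "\<lambda>z. norm (R j z)"] continuous_intros cont) auto
  show "norm (R j z - R j w) \<le> 3 * real j * norm (z - w)" if "norm z = 1" "norm w = 1" for z w
    using form_lipschitz[of c j z w] le that assms(2) by (simp add: c)
  have "bounded (R j ` sphere 0 1)" using le unfolding bounded_iff by (intro exI[of _ 1]) auto
  then show "homogeneous (int j) (R j)"
    using continuous_on_sphere_measurable[OF cont]
    by (auto simp: homogeneous_def c form_smult Complex.DeMoivre)
qed

section \<open>A Fejer kernel on tubes\<close>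

lemma homogeneous_hdot:
  assumes "norm w = 1"
  shows "homogeneous 1 (\<lambda>z. hdot z w)"
proof -
  have "bounded ((\<lambda>z. hdot z w) ` sphere 0 1)"
    unfolding bounded_iff
    by (intro exI[of _ 1]) (auto intro: order_trans[OF norm_hdot_le[OF assms]])
  moreover have "(\<lambda>z. hdot z w) \<in> borel_measurable sphere_measure"
    by (intro continuous_on_sphere_measurable continuous_intros)
  ultimately show ?thesis by (simp add: homogeneous_def hdot_smult_left)
qed

lemma homogeneous_indicator_tube: "homogeneous 0 (indicator (tube w r) :: _ \<Rightarrow> complex)"
proof -
  have "(indicator (tube w r) :: _ \<Rightarrow> complex) \<in> borel_measurable borel"
    by (intro borel_measurable_indicator borel_closed closed_tube)
  then have "(indicator (tube w r) :: _ \<Rightarrow> complex) \<in> borel_measurable sphere_measure"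
    by (simp add: measurable_restrict_space1 cong: measurable_cong_sets)
  moreover have "bounded (indicator (tube w r) ` sphere 0 1 :: complex set)"
    unfolding bounded_iff by (intro exI[of _ 1]) (auto simp: indicator_def)
  ultimately show ?thesis by (auto simp: homogeneous_def indicator_def tube_cis)
qed

text \<open>An unnormalized Fejer kernel in \<open>hdot z w\<close>, cut off to the tube. Writing
  the square as a product with the conjugate shows that its frequencies are differences of exponents
  below \<open>m\<close>.\<close>

definition tube_kernel :: "complex ^ 'n \<Rightarrow> real \<Rightarrow> nat \<Rightarrow> complex ^ 'n \<Rightarrow> complex" where
  "tube_kernel w r m z =
     indicator (tube w r) z * ((\<Sum>l<m. hdot z w ^ l) * cnj (\<Sum>l<m. hdot z w ^ l))"

lemma tube_kernel_eq_norm: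
  "tube_kernel w r m z = of_real (indicator (tube w r) z * (norm (\<Sum>l<m. hdot z w ^ l))\<^sup>2)"
  unfolding tube_kernel_def complex_norm_square[symmetric] by (simp add: indicator_def)

lemma tube_kernel_spectrum:
  assumes "norm w = 1" "m \<ge> 1"
  shows "has_spectrum {d. \<bar>d\<bar> < int m} (tube_kernel w r m)"
proof -
  have D: "has_spectrum {0..<int m} (\<lambda>z. \<Sum>l<m. hdot z w ^ l)"
  proof (intro has_spectrum_sum)
    show "{..<m} \<noteq> {}" using assms(2) by (auto simp: lessThan_empty_iff)
    show "has_spectrum {0..<int m} (\<lambda>z. hdot z w ^ l)" if "l \<in> {..<m}" for l
      using that homogeneous_power[OF homogeneous_hdot[OF assms(1)], of l]
      by (auto intro!: has_spectrum.homogeneous)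
  qed simp
  have I: "has_spectrum {0} (indicator (tube w r))"
    by (intro has_spectrum.homogeneous[OF homogeneous_indicator_tube]) simp
  have "has_spectrum {d. \<bar>d\<bar> < int m}
    (\<lambda>z. (\<Sum>l<m. hdot z w ^ l) * cnj (\<Sum>l<m. hdot z w ^ l))"
    by (rule has_spectrum_mult[OF D has_spectrum_cnj[OF D]]) auto
  from has_spectrum_mult[OF I this, of "{d. \<bar>d\<bar> < int m}"] show ?thesis
    unfolding tube_kernel_def by auto
qed

text \<open>After expanding the square, the terms with \<open>l \<noteq> k\<close> have nonzero
  degree and vanish, while each of the \<open>m\<close> diagonal terms is at most the indicator of
  the tube.\<close>

lemma tube_kernel_integral_le:
  assumes w: "norm w = 1"
  shows "Re (\<integral>z. tube_kernel w r m z \<partial>sphere_measure)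
    \<le> real m * measure sphere_measure (tube w r \<inter> sphere 0 1)"
proof -
  define g where "g l k z = indicator (tube w r) z * (hdot z w ^ l * cnj (hdot z w) ^ k)" for l k z
  have hom: "homogeneous (int l - int k) (g l k)" for l k
    using homogeneous_mult[OF homogeneous_indicator_tube[of w r]
      homogeneous_mult[OF homogeneous_power[OF homogeneous_hdot[OF w], of l]
        homogeneous_power[OF homogeneous_cnj[OF homogeneous_hdot[OF w]], of k]]]
    by (simp add: g_def[abs_def])
  note int = homogeneous_integrable[OF hom]
  have T: "tube w r \<inter> sphere 0 1 \<in> sets sphere_measure"
    by (intro sphere_in_sets_sphere_measure borel_closed closed_tube)
  have diag: "Re (\<integral>z. g l l z \<partial>sphere_measure) \<le> measure sphere_measure (tube w r \<inter> sphere 0 1)" for l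
  proof -
    have "Re (\<integral>z. g l l z \<partial>sphere_measure) = (\<integral>z. Re (g l l z) \<partial>sphere_measure)"
      using int[of l l] by simp
    also have "\<dots> \<le> (\<integral>z. indicator (tube w r \<inter> sphere 0 1) z \<partial>sphere_measure)"
    proof (rule integral_mono)
      show "integrable sphere_measure (\<lambda>z. Re (g l l z))" using int[of l l] by simp
      show "integrable sphere_measure (indicator (tube w r \<inter> sphere 0 1) :: _ \<Rightarrow> real)"
        using T by (intro integrable_real_indicator) (auto simp: sphere.emeasure_eq_measure)
      fix z :: "complex ^ 'a" assume "z \<in> space sphere_measure"
      then have z: "norm z = 1" by simp
      have "g l l z = indicator (tube w r) z * of_real ((norm (hdot z w ^ l))\<^sup>2)"
        by (simp only: g_def complex_cnj_power[symmetric] complex_norm_square)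
      moreover have "norm (hdot z w ^ l) \<le> 1"
        using norm_hdot_le[OF w, of z] z by (simp add: norm_power power_le_one)
      then have "(norm (hdot z w ^ l))\<^sup>2 \<le> 1" by (intro power_le_one) auto
      ultimately show "Re (g l l z) \<le> indicator (tube w r \<inter> sphere 0 1) z"
        using z by (simp add: indicator_def)
    qed
    also have "\<dots> = measure sphere_measure (tube w r \<inter> sphere 0 1)"
      using T by simp
    finally show ?thesis .
  qed
  have "tube_kernel w r m z = (\<Sum>l<m. \<Sum>k<m. g l k z)" for z
    by (cases "z \<in> tube w r") (simp_all add: tube_kernel_def g_def sum_product)
  then have "(\<integral>z. tube_kernel w r m z \<partial>sphere_measure) =
    (\<Sum>l<m. \<Sum>k<m. (\<integral>z. g l k z \<partial>sphere_measure))"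
    using int by simp
  also have "\<dots> = (\<Sum>l<m. \<Sum>k<m. if k = l then (\<integral>z. g l l z \<partial>sphere_measure) else 0)"
    by (intro sum.cong refl) (auto intro: homogeneous_integral_eq_0[OF hom])
  also have "\<dots> = (\<Sum>l<m. (\<integral>z. g l l z \<partial>sphere_measure))"
    by (intro sum.cong refl) (simp add: sum.delta)
  finally have "Re (\<integral>z. tube_kernel w r m z \<partial>sphere_measure) =
    (\<Sum>l<m. Re (\<integral>z. g l l z \<partial>sphere_measure))" by simp
  also have "\<dots> \<le> (\<Sum>l<m. measure sphere_measure (tube w r \<inter> sphere 0 1))"
    by (intro sum_mono diag)
  finally show ?thesis by simp
qed

text \<open>Near \<open>w\<close> the number \<open>hdot z w\<close> is within \<open>r\<close> of
  1, so the geometric sum differs from \<open>m\<close> by at most \<open>m^2 * r / 2\<close>, hence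
  by at most \<open>m / 2\<close>. Thus \<open>4 / m^2\<close> times the kernel dominates the
  indicator of the ball, while its integral is at most \<open>4 / m\<close> times the measure of the
  tube.\<close>

lemma tube_kernel_ge:
  assumes w: "norm w = 1" and z: "norm z = 1" and r: "dist z w \<le> r" "real m * r \<le> 1"
  shows "(real m)\<^sup>2 / 4 \<le> Re (tube_kernel w r m z)"
proof -
  let ?h = "hdot z w"
  have h1: "norm (?h - 1) \<le> r"
  proof -
    have "?h - 1 = hdot (z - w) w" using w by (simp add: hdot_diff_left hdot_self)
    then show ?thesis using norm_hdot_le[OF w, of "z - w"] r(1) by (simp add: dist_norm)
  qed
  have r0: "r \<ge> 0" using r(1) zero_le_dist[of z w] by linarith
  have h: "norm ?h \<le> 1" using norm_hdot_le[OF w, of z] z by simp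
  have sum_le: "(\<Sum>l<m. real l) \<le> real m * real m / 2"
    by (induction m) (auto simp: field_simps)
  have "norm ((\<Sum>l<m. ?h ^ l) - (\<Sum>l<m. 1 ^ l)) \<le> (\<Sum>l<m. norm (?h ^ l - 1 ^ l))"
    unfolding sum_subtractf[symmetric] by (rule norm_sum)
  also have "\<dots> \<le> (\<Sum>l<m. real l * r)"
  proof (intro sum_mono)
    fix l
    have "norm (?h ^ l - 1 ^ l) \<le> real l * norm (?h - 1)"
      by (rule norm_power_diff) (use h in auto)
    also have "\<dots> \<le> real l * r" using h1 by (intro mult_left_mono) auto
    finally show "norm (?h ^ l - 1 ^ l) \<le> real l * r" .
  qed
  also have "\<dots> \<le> (real m * real m / 2) * r"
    unfolding sum_distrib_right[symmetric] using sum_le r0 by (intro mult_right_mono) auto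
  also have "\<dots> = (real m / 2) * (real m * r)" by simp
  also have "\<dots> \<le> (real m / 2) * 1" using r(2) by (intro mult_left_mono) auto
  finally have "norm (of_nat m - (\<Sum>l<m. ?h ^ l)) \<le> real m / 2"
    by (simp add: norm_minus_commute)
  then have "real m / 2 \<le> norm (\<Sum>l<m. ?h ^ l)"
    using norm_triangle_ineq2[of "of_nat m" "\<Sum>l<m. ?h ^ l"] by simp
  then have "(real m / 2)\<^sup>2 \<le> (norm (\<Sum>l<m. ?h ^ l))\<^sup>2" by (intro power_mono) auto
  moreover have "z \<in> tube w r" using dist_imp_in_tube[OF w r(1)] .
  ultimately show ?thesis by (simp add: tube_kernel_eq_norm power_divide)
qed

section \<open>Riesz products\<close>

locale riesz =
  fixes R :: "nat \<Rightarrow> complex ^ 'n \<Rightarrow> complex" and J :: "nat \<Rightarrow> nat" and a :: "nat \<Rightarrow> complex"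
  assumes triple: "riesz_triple R J a"
begin

text \<open>In the notation of the introduction, \<open>osc\<close>, \<open>osc_re\<close>,
  \<open>osc_ctr\<close> and \<open>osc_sum\<close> are \<open>u\<^sub>k\<close>,
  \<open>x\<^sub>k\<close>, \<open>y\<^sub>k\<close> and \<open>S\<^sub>N\<close>.\<close>

definition osc :: "nat \<Rightarrow> complex ^ 'n \<Rightarrow> complex" where
  "osc k z = a k * R (J k) z"

definition osc_re :: "nat \<Rightarrow> complex ^ 'n \<Rightarrow> real" where
  "osc_re k z = Re (osc k z)"

text \<open>The subtracted term is the average of \<open>osc_re k\<close> over a circle orbit
  weighted by the factor \<open>1 + osc_re k\<close>.\<close>

definition osc_ctr :: "nat \<Rightarrow> complex ^ 'n \<Rightarrow> real" where
  "osc_ctr k z = osc_re k z - (norm (osc k z))\<^sup>2 / 2"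

definition riesz_density :: "nat \<Rightarrow> complex ^ 'n \<Rightarrow> real" where
  "riesz_density N z = (\<Prod>k\<in>{0<..N}. 1 + osc_re k z)"

definition osc_sum :: "nat \<Rightarrow> complex ^ 'n \<Rightarrow> real" where
  "osc_sum N z = (\<Sum>k\<in>{0<..N}. osc_re k z)"

section \<open>Pointwise bounds for factors, densities and sums\<close>

lemma RW: obtains \<delta> where "RW_sequence \<delta> R"
  using triple by (auto simp: riesz_triple_def)

lemma J_ge_1: "k \<ge> 1 \<Longrightarrow> J k \<ge> 1"
  using triple by (auto simp: riesz_triple_def Suc_le_eq)

lemma J_Suc: "k \<ge> 1 \<Longrightarrow> 3 * J k \<le> J (Suc k)"
proof -
  assume k: "k \<ge> 1"
  then have "3 \<le> real (J (Suc k)) / real (J k)" "J k > 0"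
    using triple by (auto simp: riesz_triple_def)
  then have "real (3 * J k) \<le> real (J (Suc k))" by (simp add: field_simps)
  then show ?thesis by (simp only: of_nat_le_iff)
qed

lemma norm_a: "k \<ge> 1 \<Longrightarrow> norm (a k) < 1"
  using triple by (auto simp: riesz_triple_def)

lemma norm_osc_le: "k \<ge> 1 \<Longrightarrow> norm z = 1 \<Longrightarrow> norm (osc k z) \<le> norm (a k)"
  using RW_sequence_norm_le[OF _ J_ge_1, of _ R k z] RW
  by (metis osc_def mult_left_le norm_ge_zero norm_mult)

lemma homogeneous_osc: "k \<ge> 1 \<Longrightarrow> homogeneous (int (J k)) (osc k)"
  using RW_sequence_homogeneous[OF _ J_ge_1, of _ R k] RW
  unfolding osc_def[abs_def] by (metis homogeneous_cmult)

lemma continuous_osc: "k \<ge> 1 \<Longrightarrow> continuous_on (sphere 0 1) (osc k)"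
  using RW_sequence_continuous[OF _ J_ge_1, of _ R k] RW
  unfolding osc_def[abs_def] by (metis continuous_on_mult_left)

lemma continuous_osc_re: "k \<ge> 1 \<Longrightarrow> continuous_on (sphere 0 1) (osc_re k)"
  unfolding osc_re_def[abs_def] by (intro continuous_intros continuous_osc)

lemma continuous_osc_ctr: "k \<ge> 1 \<Longrightarrow> continuous_on (sphere 0 1) (osc_ctr k)"
  unfolding osc_ctr_def[abs_def] by (intro continuous_intros continuous_osc continuous_osc_re) auto

lemma continuous_riesz_density: "continuous_on (sphere 0 1) (riesz_density N)"
  unfolding riesz_density_def[abs_def] by (intro continuous_intros continuous_osc_re) auto

lemma continuous_osc_sum: "continuous_on (sphere 0 1) (osc_sum N)"
  unfolding osc_sum_def[abs_def] by (intro continuous_intros continuous_osc_re) auto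

lemma abs_osc_re_le: "k \<ge> 1 \<Longrightarrow> norm z = 1 \<Longrightarrow> \<bar>osc_re k z\<bar> \<le> norm (a k)"
  using norm_osc_le[of k z] abs_Re_le_cmod[of "osc k z"] by (simp add: osc_re_def)

lemma factor_nonneg: "k \<ge> 1 \<Longrightarrow> norm z = 1 \<Longrightarrow> 0 \<le> 1 + osc_re k z"
  using abs_osc_re_le[of k z] norm_a[of k] by linarith

lemma riesz_density_nonneg: "norm z = 1 \<Longrightarrow> 0 \<le> riesz_density N z"
  unfolding riesz_density_def by (intro prod_nonneg) (auto intro: factor_nonneg)

lemma riesz_density_le_exp: "norm z = 1 \<Longrightarrow> riesz_density N z \<le> exp (osc_sum N z)"
  unfolding riesz_density_def osc_sum_def exp_sum[OF finite_greaterThanAtMost]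
  using factor_nonneg by (intro prod_mono) auto

lemma osc_re_lipschitz:
  assumes "k \<ge> 1" "norm z = 1" "norm w = 1"
  shows "osc_re k z - osc_re k w \<le> 3 * real (J k) * norm (z - w)"
proof -
  obtain \<delta> where "RW_sequence \<delta> R" using RW .
  then have *: "norm (R (J k) z - R (J k) w) \<le> 3 * real (J k) * norm (z - w)"
    using assms J_ge_1 by (intro RW_sequence_lipschitz) auto
  have "osc_re k z - osc_re k w = Re (osc k z - osc k w)" by (simp add: osc_re_def)
  also have "\<dots> \<le> norm (osc k z - osc k w)" by (rule complex_Re_le_cmod)
  also have "\<dots> = norm (a k) * norm (R (J k) z - R (J k) w)"
    by (simp add: osc_def norm_mult[symmetric] right_diff_distrib)
  also have "\<dots> \<le> 1 * norm (R (J k) z - R (J k) w)"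
    using norm_a[OF assms(1)] by (intro mult_right_mono) auto
  finally show ?thesis using * by simp
qed

text \<open>Geometric growth with ratio at least 3: the sum is at most
  \<open>1 + 1/3 + 1/9 + ... = 3/2\<close> times its last term.\<close>

lemma sum_J_le: "2 * (\<Sum>k\<in>{0<..N}. real (J k)) \<le> 3 * real (J N)"
proof (induction N)
  case (Suc N)
  have "{0<..Suc N} = insert (Suc N) {0<..N}" by auto
  \<comment> \<open>The growth condition starts at index 1 and says nothing about
    \<open>J 0\<close>; for \<open>N = 0\<close> the earlier sum is empty.\<close>
  moreover have "real (3 * J N) \<le> real (J (Suc N)) \<or> N = 0"
    using J_Suc[of N] by (cases "N = 0") (auto simp only: of_nat_le_iff)
  ultimately show ?case using Suc by auto
qed simp

text \<open>The highest frequency dominates the sum of the Lipschitz constants, so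
  \<open>osc_sum N\<close> varies by at most \<open>9 / 2\<close> over a distance
  \<open>1 / J N\<close>.\<close>

lemma osc_sum_lipschitz:
  assumes "norm z = 1" "norm w = 1"
  shows "osc_sum N z \<le> osc_sum N w + 9 / 2 * real (J N) * norm (z - w)"
proof -
  have "osc_sum N z - osc_sum N w = (\<Sum>k\<in>{0<..N}. osc_re k z - osc_re k w)"
    by (simp add: osc_sum_def sum_subtractf)
  also have "\<dots> \<le> (\<Sum>k\<in>{0<..N}. 3 * real (J k) * norm (z - w))"
    using assms by (intro sum_mono osc_re_lipschitz) auto
  also have "\<dots> = 3 / 2 * (2 * (\<Sum>k\<in>{0<..N}. real (J k))) * norm (z - w)"
    by (simp add: sum_distrib_left sum_distrib_right mult_ac)
  also have "\<dots> \<le> 3 / 2 * (3 * real (J N)) * norm (z - w)"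
    using sum_J_le by (intro mult_right_mono mult_left_mono) auto
  finally show ?thesis by simp
qed

section \<open>Frequencies of the plain and the tilted factors\<close>

lemma osc_re_eq: "complex_of_real (osc_re k z) = (osc k z + cnj (osc k z)) / 2"
  by (simp add: osc_re_def complex_eq_iff)

lemma has_spectrum_osc:
  assumes "k \<ge> 1"
  shows "has_spectrum {int (J k)} (osc k)" "has_spectrum {- int (J k)} (\<lambda>z. cnj (osc k z))"
  using has_spectrum.homogeneous[OF homogeneous_osc[OF assms]]
    has_spectrum.homogeneous[OF homogeneous_cnj[OF homogeneous_osc[OF assms]]] by auto

lemma factor_spectrum:
  assumes k: "k \<ge> 1"
  shows "has_spectrum {d. int (J k) \<le> \<bar>d\<bar> \<and> \<bar>d\<bar> \<le> 2 * int (J k)}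
    (\<lambda>z. complex_of_real (1 + osc_re k z) - 1)"
proof -
  have "has_spectrum {d. int (J k) \<le> \<bar>d\<bar> \<and> \<bar>d\<bar> \<le> 2 * int (J k)} (\<lambda>z. 1 / 2 * osc k z + 1 / 2 * cnj (osc k z))"
    using has_spectrum_osc[OF k]
    by (intro has_spectrum.add has_spectrum_cmult; elim has_spectrum_mono) auto
  moreover have "(\<lambda>z. 1 / 2 * osc k z + 1 / 2 * cnj (osc k z)) = (\<lambda>z. complex_of_real (1 + osc_re k z) - 1)"
    by (simp add: osc_re_eq add_divide_distrib)
  ultimately show ?thesis by simp
qed

text \<open>
  Since \<open>(1 + x\<^sub>k)(x\<^sub>k - |u\<^sub>k|\<^sup>2/2)\<close> has no mode of frequency \<open>0\<close>, the tilted factor still has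
  constant mode \<open>1\<close>.
\<close>

lemma tilted_factor_spectrum:
  assumes k: "k \<ge> 1"
  shows "has_spectrum {d. int (J k) \<le> \<bar>d\<bar> \<and> \<bar>d\<bar> \<le> 2 * int (J k)}
    (\<lambda>z. complex_of_real ((1 + osc_re k z) * (1 + c * osc_ctr k z)) - 1)"
proof -
  let ?D = "{d. int (J k) \<le> \<bar>d\<bar> \<and> \<bar>d\<bar> \<le> 2 * int (J k)}"
  let ?osc = "osc k" and ?v = "\<lambda>z. cnj (osc k z)" and ?c = "complex_of_real c"
  note s = has_spectrum_osc[OF k]
  have uv: "has_spectrum {0} (\<lambda>z. ?osc z * ?v z)" by (rule has_spectrum_mult[OF s]) auto
  have 1: "has_spectrum {0} (\<lambda>z. (1 + ?c) / 2 + - ?c / 4 * (?osc z * ?v z))"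
    by (intro has_spectrum.add has_spectrum_cmult uv has_spectrum.homogeneous[OF homogeneous_const]) auto
  have 2: "has_spectrum ?D (\<lambda>z. ?osc z + ?v z)"
    by (intro has_spectrum.add has_spectrum_mono[OF s(1)] has_spectrum_mono[OF s(2)]) auto
  have 3: "has_spectrum ?D (\<lambda>z. ((1 + ?c) / 2 + - ?c / 4 * (?osc z * ?v z)) * (?osc z + ?v z))"
    by (rule has_spectrum_mult[OF 1 2]) auto
  have 4: "has_spectrum ?D (\<lambda>z. ?c / 4 * (?osc z * ?osc z) + ?c / 4 * (?v z * ?v z))"
    by (intro has_spectrum.add has_spectrum_cmult has_spectrum_mult[OF s(1) s(1)]
      has_spectrum_mult[OF s(2) s(2)]) auto
  \<comment> \<open>With \<open>v = cnj u\<close>, \<open>x = (u + v) / 2\<close> and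
    \<open>y = x - u v / 2\<close>, the mixed term of \<open>c x^2\<close> cancels
    \<open>- c u v / 2\<close>. What remains has the frequencies \<open>J k\<close> and
    \<open>2 * J k\<close> up to sign.\<close>
  have "complex_of_real ((1 + osc_re k z) * (1 + c * osc_ctr k z)) - 1 =
    ((1 + ?c) / 2 + - ?c / 4 * (?osc z * ?v z)) * (?osc z + ?v z) +
    (?c / 4 * (?osc z * ?osc z) + ?c / 4 * (?v z * ?v z))" for z
    by (simp add: osc_ctr_def osc_re_eq of_real_power[symmetric] complex_norm_square del: of_real_power)
       (simp add: field_simps)
  then show ?thesis using has_spectrum.add[OF 3 4] by simp
qed

section \<open>The Riesz product as a limit of densities\<close>

lemma integral_riesz_partial:
  assumes f: "f \<in> borel_measurable sphere_measure"
  shows "(\<integral>z. f z \<partial>riesz_partial R J a N) =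
    (\<integral>z. complex_of_real (riesz_density N z) * f z \<partial>sphere_measure)"
proof -
  have fac: "cnj (a k) * cnj (R (J k) z) / 2 + 1 + a k * R (J k) z / 2 = complex_of_real (1 + osc_re k z)"
    for k z by (simp add: osc_re_eq osc_def add_divide_distrib)
  have N: "{1..N} = {0<..N}" by auto
  have "riesz_partial R J a N = density sphere_measure (\<lambda>z. ennreal (riesz_density N z))"
    by (simp only: riesz_partial_def riesz_density_def fac of_real_prod[symmetric] N
      Re_complex_of_real)
  moreover have "riesz_density N \<in> borel_measurable sphere_measure"
    by (intro continuous_on_sphere_measurable continuous_riesz_density)
  ultimately show ?thesis
    using f riesz_density_nonneg
    by (simp only:, subst Bochner_Integration.integral_density) (auto simp: scaleR_conv_of_real)
qed

lemma riesz_product_tendsto: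
  fixes f :: "complex ^ 'n \<Rightarrow> real"
  assumes \<mu>: "riesz_product R J a \<mu>" and f: "continuous_on (sphere 0 1) f"
  shows "(\<lambda>N. \<integral>z. riesz_density N z * f z \<partial>sphere_measure) \<longlonglongrightarrow> (\<integral>z. f z \<partial>\<mu>)"
proof -
  have c: "continuous_on (sphere 0 1) (\<lambda>z. complex_of_real (f z))"
    using f by (intro continuous_intros)
  have "(\<lambda>N. \<integral>z. complex_of_real (f z) \<partial>riesz_partial R J a N) \<longlonglongrightarrow> (\<integral>z. complex_of_real (f z) \<partial>\<mu>)"
    using \<mu> c unfolding riesz_product_def weak_star_limit_def by blast
  then show ?thesis
    unfolding integral_riesz_partial[OF continuous_on_sphere_measurable[OF c]]
    unfolding of_real_mult[symmetric] integral_complex_of_real tendsto_of_real_iff .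
qed


section \<open>Mass of small balls\<close>

lemma integrable_density_indicator:
  assumes "A \<in> sets borel"
  shows "integrable sphere_measure (\<lambda>z. riesz_density M z * indicator A z)"
proof (rule Bochner_Integration.integrable_bound[OF sphere_integrable[OF continuous_riesz_density]])
  have "(indicator A :: complex ^ 'n \<Rightarrow> real) \<in> borel_measurable borel"
    using assms by (rule borel_measurable_indicator)
  then have "(indicator A :: complex ^ 'n \<Rightarrow> real) \<in> borel_measurable sphere_measure"
    by (simp add: measurable_restrict_space1 cong: measurable_cong_sets)
  then show "(\<lambda>z. riesz_density M z * indicator A z) \<in> borel_measurable sphere_measure"
    by (rule borel_measurable_times[OF continuous_on_sphere_measurable[OF continuous_riesz_density]])
  show "AE z in sphere_measure. norm (riesz_density M z * indicator A z) \<le> norm (riesz_density M z)"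
    by (auto simp: indicator_def)
qed

text \<open>The kernel has frequencies below \<open>m \<le> J (Suc N)\<close>, so the factors beyond
  \<open>N\<close> do not change its integral. The bound is uniform in \<open>M\<close>.\<close>

lemma integral_tube_tail_le:
  assumes w: "norm w = 1" and m: "1 \<le> m" "m \<le> J (Suc N)" and NM: "N \<le> M"
  shows "integrable sphere_measure
      (\<lambda>z. Re (tube_kernel w r m z) * (\<Prod>k\<in>{N<..M}. 1 + osc_re k z))"
    and "(\<integral>z. Re (tube_kernel w r m z) * (\<Prod>k\<in>{N<..M}. 1 + osc_re k z) \<partial>sphere_measure)
      \<le> real m * measure sphere_measure (tube w r \<inter> sphere 0 1)"
proof -
  let ?P = "\<lambda>z. tube_kernel w r m z * (\<Prod>k\<in>{N<..M}. complex_of_real (1 + osc_re k z))"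
  have Q: "has_spectrum {d. \<bar>d\<bar> < int (J (Suc N))} (tube_kernel w r m)"
    by (rule has_spectrum_mono[OF tube_kernel_spectrum[OF w m(1)]]) (use m(2) in auto)
  have J: "3 * J k \<le> J (Suc k)" if "k > N" "k \<le> M" for k
    using that by (intro J_Suc) simp
  have G: "has_spectrum {d. int (J k) \<le> \<bar>d\<bar> \<and> \<bar>d\<bar> \<le> 2 * int (J k)}
    (\<lambda>z. complex_of_real (1 + osc_re k z) - 1)" if "k > N" "k \<le> M" for k
    using that by (intro factor_spectrum) simp
  note s = integral_spectral_product[OF J Q G NM]
  have eq: "Re (?P z) = Re (tube_kernel w r m z) * (\<Prod>k\<in>{N<..M}. 1 + osc_re k z)" for z
    unfolding of_real_prod[symmetric]
    by (simp only: times_complex.sel Re_complex_of_real Im_complex_of_real mult_zero_right diff_zero)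
  have i: "integrable sphere_measure ?P" by (rule has_spectrum_integrable[OF s(1)])
  show "integrable sphere_measure
      (\<lambda>z. Re (tube_kernel w r m z) * (\<Prod>k\<in>{N<..M}. 1 + osc_re k z))"
    unfolding eq[symmetric] using i by (rule integrable_Re)
  show "(\<integral>z. Re (tube_kernel w r m z) * (\<Prod>k\<in>{N<..M}. 1 + osc_re k z) \<partial>sphere_measure)
      \<le> real m * measure sphere_measure (tube w r \<inter> sphere 0 1)"
    unfolding eq[symmetric] integral_Re[OF i] using s(2) tube_kernel_integral_le[OF w, of r m]
    by (simp only:)
qed

text \<open>The first \<open>N\<close> factors are replaced on the ball by a constant multiple of
  \<open>exp (osc_sum N w)\<close>; the others are integrated against the kernel. The tube
  contributes \<open>r ^ (2 * CARD('n) - 2)\<close> and the circle direction one more power of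
  \<open>r\<close>.\<close>

lemma integral_density_cball_le:
  obtains K where "K > 0"
    "\<And>w r N M. norm w = 1 \<Longrightarrow> 0 < r \<Longrightarrow> r \<le> 1 \<Longrightarrow> N \<ge> 1 \<Longrightarrow> J N \<le> 1 / r \<Longrightarrow>
      1 / r \<le> J (Suc N) \<Longrightarrow> N \<le> M \<Longrightarrow>
      (\<integral>z. riesz_density M z * indicator (cball w r) z \<partial>sphere_measure)
        \<le> K * r ^ (2 * CARD('n) - 1) * exp (osc_sum N w)"
proof -
  obtain C where C: "C > 0" "\<And>w r. norm w = 1 \<Longrightarrow> 0 < r \<Longrightarrow> r \<le> 1 \<Longrightarrow>
      measure sphere_measure (tube w r \<inter> sphere 0 1 :: (complex ^ 'n) set)
        \<le> C * r ^ (2 * CARD('n) - 2)"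
    by (rule measure_sphere_tube_le) blast
  show ?thesis
  proof
    show "8 * C * exp (9 / 2) > 0" using C by simp
    fix w :: "complex ^ 'n" and r :: real and N M :: nat
    assume w: "norm w = 1" and r: "0 < r" "r \<le> 1" and N: "N \<ge> 1" "J N \<le> 1 / r"
      and "1 / r \<le> J (Suc N)" and NM: "N \<le> M"
    \<comment> \<open>This \<open>m\<close> meets three demands: \<open>m * r \<le> 1\<close> for
      the lower bound on the kernel, \<open>m \<le> J (Suc N)\<close> for the spectrum, and
      \<open>1 / m \<le> 2 * r\<close> for the gain of a factor \<open>r\<close>.\<close>
    define m where "m = nat \<lfloor>1 / r\<rfloor>"
    have r1: "1 \<le> 1 / r" using r by simp
    then have m: "real m \<le> 1 / r" "1 / r < real m + 1" "1 \<le> m"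
      unfolding m_def by (simp_all add: le_nat_iff) linarith+
    have mJ: "m \<le> J (Suc N)" using m(1) \<open>1 / r \<le> J (Suc N)\<close> by (simp flip: of_nat_le_iff)
    have mr: "real m * r \<le> 1" using m(1) r by (simp add: field_simps)
    have mr': "1 \<le> 2 * (real m * r)"
    proof -
      have "1 / r \<le> 2 * real m" using m by simp
      then show ?thesis using r by (simp add: field_simps)
    qed
    define c where "c = exp (9 / 2) * exp (osc_sum N w) * (4 / (real m)\<^sup>2)"
    let ?T = "\<lambda>z. \<Prod>k\<in>{N<..M}. 1 + osc_re k z"
    let ?q = "\<lambda>z. Re (tube_kernel w r m z)"
    have T0: "0 \<le> ?T z" if "norm z = 1" for z
      using that by (intro prod_nonneg) (auto intro: factor_nonneg)
    have q0: "0 \<le> ?q z" for z by (simp add: tube_kernel_eq_norm)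
    have dens: "riesz_density M z = riesz_density N z * ?T z" for z
    proof -
      have "{0<..M} = {0<..N} \<union> {N<..M}" "{0<..N} \<inter> {N<..M} = {}" using NM by auto
      then show ?thesis by (simp add: riesz_density_def prod.union_disjoint)
    qed
    have le: "riesz_density M z * indicator (cball w r) z \<le> c * (?q z * ?T z)" if z: "norm z = 1" for z
    proof (cases "z \<in> cball w r")
      case True
      then have d: "dist z w \<le> r" by (simp add: dist_commute)
      have "9 / 2 * real (J N) * norm (z - w) \<le> 9 / 2 * (1 / r) * r"
        using d N r by (intro mult_mono) (auto simp: dist_norm)
      then have "osc_sum N z \<le> 9 / 2 + osc_sum N w"
        using osc_sum_lipschitz[OF z w, of N] r by simp
      then have "riesz_density N z \<le> exp (9 / 2) * exp (osc_sum N w)"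
        using riesz_density_le_exp[OF z, of N] by (simp add: exp_add[symmetric] order_trans)
      moreover have "1 \<le> 4 / (real m)\<^sup>2 * ?q z"
        using tube_kernel_ge[OF w z d mr] m(3) by (simp add: field_simps)
      ultimately have "riesz_density N z * 1 \<le> (exp (9 / 2) * exp (osc_sum N w)) * (4 / (real m)\<^sup>2 * ?q z)"
        by (intro mult_mono) auto
      then have "riesz_density N z * ?T z \<le> (exp (9 / 2) * exp (osc_sum N w)) * (4 / (real m)\<^sup>2 * ?q z) * ?T z"
        using T0[OF z] by (intro mult_right_mono) auto
      then show ?thesis using True by (simp add: dens c_def mult_ac)
    next
      case False
      then show ?thesis using q0 T0[OF z] by (simp add: c_def)
    qed
    have "(\<integral>z. riesz_density M z * indicator (cball w r) z \<partial>sphere_measure)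
      \<le> (\<integral>z. c * (?q z * ?T z) \<partial>sphere_measure)"
    proof (rule integral_mono)
      show "integrable sphere_measure (\<lambda>z. riesz_density M z * indicator (cball w r) z)"
        by (rule integrable_density_indicator) simp
      show "integrable sphere_measure (\<lambda>z. c * (?q z * ?T z))"
        by (intro integrable_mult_right integral_tube_tail_le(1) w m mJ NM)
      show "riesz_density M z * indicator (cball w r) z \<le> c * (?q z * ?T z)"
        if "z \<in> space sphere_measure" for z using that le by simp
    qed
    also have "\<dots> = c * (\<integral>z. ?q z * ?T z \<partial>sphere_measure)" by simp
    also have "\<dots> \<le> c * (real m * (C * r ^ (2 * CARD('n) - 2)))"
    proof (intro mult_left_mono)
      show "(\<integral>z. ?q z * ?T z \<partial>sphere_measure) \<le> real m * (C * r ^ (2 * CARD('n) - 2))"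
        by (rule order_trans[OF integral_tube_tail_le(2)[OF w m(3) mJ NM]])
           (intro mult_left_mono C(2) w r; simp)
      show "0 \<le> c" by (simp add: c_def)
    qed
    also have "\<dots> = exp (9 / 2) * exp (osc_sum N w) * 4 * C * r ^ (2 * CARD('n) - 2) * (1 / real m)"
      using m(3) by (simp add: c_def power2_eq_square field_simps)
    also have "\<dots> \<le> exp (9 / 2) * exp (osc_sum N w) * 4 * C * r ^ (2 * CARD('n) - 2) * (2 * r)"
      using mr' m(3) r C by (intro mult_left_mono) (auto simp: field_simps)
    also have "\<dots> = 8 * C * exp (9 / 2) * r ^ (2 * CARD('n) - 1) * exp (osc_sum N w)"
    proof -
      have "0 < CARD('n)" by simp
      then have "2 * CARD('n) - 1 = Suc (2 * CARD('n) - 2)" by linarith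
      then show ?thesis by simp
    qed
    finally show "(\<integral>z. riesz_density M z * indicator (cball w r) z \<partial>sphere_measure)
        \<le> 8 * C * exp (9 / 2) * r ^ (2 * CARD('n) - 1) * exp (osc_sum N w)" .
  qed
qed

text \<open>Weak convergence tests continuous functions only. A cutoff equal to 1 on the ball of
  radius \<open>r\<close> and 0 outside that of radius \<open>2 * r\<close> is used, hence the
  doubled radius in the conditions and the bound.\<close>

lemma riesz_product_cball_le:
  assumes \<mu>: "riesz_product R J a \<mu>"
  obtains K where "K > 0"
    "\<And>w r N. norm w = 1 \<Longrightarrow> 0 < r \<Longrightarrow> 2 * r \<le> 1 \<Longrightarrow> N \<ge> 1 \<Longrightarrow> J N \<le> 1 / (2 * r) \<Longrightarrow>
      1 / (2 * r) \<le> J (Suc N) \<Longrightarrow>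
      measure \<mu> (cball w r \<inter> sphere 0 1)
        \<le> K * (2 * r) ^ (2 * CARD('n) - 1) * exp (osc_sum N w)"
proof -
  have sets: "sets \<mu> = sets (restrict_space borel (sphere 0 1))" and "prob_space \<mu>"
    using \<mu> by (auto simp: riesz_product_def)
  then interpret prob_space \<mu> by simp
  have space: "space \<mu> = sphere 0 1"
    using sets_eq_imp_space_eq[OF sets] by (simp add: space_restrict_space)
  obtain K where K: "K > 0" "\<And>w r N M. norm w = 1 \<Longrightarrow> 0 < r \<Longrightarrow> r \<le> 1 \<Longrightarrow> N \<ge> 1 \<Longrightarrow> J N \<le> 1 / r \<Longrightarrow>
      1 / r \<le> J (Suc N) \<Longrightarrow> N \<le> M \<Longrightarrow>
      (\<integral>z. riesz_density M z * indicator (cball w r) z \<partial>sphere_measure)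
        \<le> K * r ^ (2 * CARD('n) - 1) * exp (osc_sum N w)"
    by (rule integral_density_cball_le) blast
  show ?thesis
  proof
    show "K > 0" by fact
    fix w :: "complex ^ 'n" and r :: real and N :: nat
    assume w: "norm w = 1" and r: "0 < r" "2 * r \<le> 1" and N: "N \<ge> 1" "J N \<le> 1 / (2 * r)"
      and JN: "1 / (2 * r) \<le> J (Suc N)"
    define f where "f z = max 0 (min 1 (2 - dist w z / r))" for z
    have f: "continuous_on A f" for A
      unfolding f_def by (intro continuous_intros) (use r in auto)
    have f_le: "f z \<le> indicator (cball w (2 * r)) z" for z
      using r by (auto simp: f_def indicator_def field_simps)
    have f_ge: "indicator (cball w r \<inter> sphere 0 1) z \<le> f z" for z
      using r by (auto simp: f_def indicator_def field_simps)
    have f01: "0 \<le> f z" "f z \<le> 1" for z by (auto simp: f_def)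
    have B: "cball w r \<inter> sphere 0 1 \<in> sets \<mu>"
      by (auto simp: sets sets_restrict_space)
    have fm: "f \<in> borel_measurable \<mu>"
      using continuous_on_sphere_measurable[OF f] sets by (simp cong: measurable_cong_sets)
    have "measure \<mu> (cball w r \<inter> sphere 0 1) = (\<integral>z. indicator (cball w r \<inter> sphere 0 1) z \<partial>\<mu>)"
      using B by simp
    also have "\<dots> \<le> (\<integral>z. f z \<partial>\<mu>)"
    proof (rule integral_mono)
      show "integrable \<mu> (indicator (cball w r \<inter> sphere 0 1) :: _ \<Rightarrow> real)"
        using B by (intro integrable_real_indicator) (auto simp: emeasure_eq_measure)
      show "integrable \<mu> f"
        using fm f01 by (intro integrable_const_bound[where B = 1]) auto
    qed (use f_ge in auto)
    also have "\<dots> \<le> K * (2 * r) ^ (2 * CARD('n) - 1) * exp (osc_sum N w)"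
    proof (rule LIMSEQ_le_const2[OF riesz_product_tendsto[OF \<mu> f]])
      have "(\<integral>z. riesz_density M z * f z \<partial>sphere_measure)
          \<le> K * (2 * r) ^ (2 * CARD('n) - 1) * exp (osc_sum N w)" if "M \<ge> N" for M
      proof -
        have "(\<integral>z. riesz_density M z * f z \<partial>sphere_measure)
          \<le> (\<integral>z. riesz_density M z * indicator (cball w (2 * r)) z \<partial>sphere_measure)"
        proof (rule integral_mono)
          show "integrable sphere_measure (\<lambda>z. riesz_density M z * f z)"
            by (intro sphere_integrable continuous_intros f continuous_riesz_density)
          show "integrable sphere_measure (\<lambda>z. riesz_density M z * indicator (cball w (2 * r)) z)"
            by (rule integrable_density_indicator) simp
          show "riesz_density M z * f z \<le> riesz_density M z * indicator (cball w (2 * r)) z"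
            if "z \<in> space sphere_measure" for z
            using that by (intro mult_left_mono f_le riesz_density_nonneg) simp
        qed
        also have "\<dots> \<le> K * (2 * r) ^ (2 * CARD('n) - 1) * exp (osc_sum N w)"
          using r by (intro K(2) w N JN that) auto
        finally show ?thesis .
      qed
      then show "\<exists>N'. \<forall>M\<ge>N'. (\<integral>z. riesz_density M z * f z \<partial>sphere_measure)
          \<le> K * (2 * r) ^ (2 * CARD('n) - 1) * exp (osc_sum N w)" by blast
    qed
    finally show "measure \<mu> (cball w r \<inter> sphere 0 1)
        \<le> K * (2 * r) ^ (2 * CARD('n) - 1) * exp (osc_sum N w)" .
  qed
qed

section \<open>The law of large numbers\<close>


text \<open>A substitute for the exponential of \<open>c\<close> times the sum of the
  \<open>osc_ctr k\<close>, in product form so that its integral can be computed exactly.\<close>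

definition tilt :: "real \<Rightarrow> nat \<Rightarrow> complex ^ 'n \<Rightarrow> real" where
  "tilt c N z = (\<Prod>k\<in>{0<..N}. 1 + c * osc_ctr k z)"

lemma continuous_tilt: "continuous_on (sphere 0 1) (tilt c N)"
  unfolding tilt_def[abs_def] by (intro continuous_intros continuous_osc_ctr) auto

text \<open>Factors up to \<open>N\<close> are tilted and later ones are plain. Both kinds are 1
  plus frequencies between \<open>J k\<close> and \<open>2 * J k\<close>, so the whole product
  integrates like the constant 1.\<close>

lemma integral_density_tilt:
  assumes NM: "N \<le> M"
  shows "(\<integral>z. riesz_density M z * tilt c N z \<partial>sphere_measure) = 1"
proof -
  define G where
    "G k z = (if k \<le> N then complex_of_real ((1 + osc_re k z) * (1 + c * osc_ctr k z))
       else complex_of_real (1 + osc_re k z))" for k z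
  have J: "3 * J k \<le> J (Suc k)" if "k > 0" "k \<le> M" for k
    using that by (intro J_Suc) simp
  have G: "has_spectrum {d. int (J k) \<le> \<bar>d\<bar> \<and> \<bar>d\<bar> \<le> 2 * int (J k)} (\<lambda>z. G k z - 1)"
    if "k > 0" "k \<le> M" for k
    using that factor_spectrum[of k] tilted_factor_spectrum[of k c]
    by (cases "k \<le> N") (simp_all only: G_def if_True if_False Suc_le_eq One_nat_def)
  have Q: "has_spectrum {d. \<bar>d\<bar> < int (J (Suc 0))} (\<lambda>z. 1)"
    using J_ge_1[of 1] by (intro has_spectrum.homogeneous[OF homogeneous_const]) auto
  have "(\<Prod>k\<in>{0<..M}. G k z) = complex_of_real (riesz_density M z * tilt c N z)" for z
  proof -
    have "(\<Prod>k\<in>{0<..M}. if k \<le> N then 1 + c * osc_ctr k z else 1) = tilt c N z"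
      unfolding tilt_def using NM by (intro prod.mono_neutral_cong_right) auto
    then have "riesz_density M z * tilt c N z =
      (\<Prod>k\<in>{0<..M}. (1 + osc_re k z) * (if k \<le> N then 1 + c * osc_ctr k z else 1))"
      by (simp only: riesz_density_def prod.distrib)
    moreover have "G k z = complex_of_real ((1 + osc_re k z) * (if k \<le> N then 1 + c * osc_ctr k z else 1))" for k
      by (simp add: G_def)
    ultimately show ?thesis by (simp only: of_real_prod)
  qed
  then have "(\<integral>z. complex_of_real (riesz_density M z * tilt c N z) \<partial>sphere_measure) =
    (\<integral>z. 1 * (\<Prod>k\<in>{0<..M}. G k z) \<partial>sphere_measure)" by simp
  also have "\<dots> = (\<integral>z. 1 \<partial>(sphere_measure :: (complex ^ 'n) measure))"
    by (rule integral_spectral_product(2)[OF J Q G]) auto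
  also have "\<dots> = complex_of_real 1" using sphere.prob_space[where 'a = "complex ^ 'n"] by simp
  finally show ?thesis by (simp only: integral_complex_of_real of_real_eq_iff)
qed

lemma riesz_product_integral_tilt:
  assumes "riesz_product R J a \<mu>"
  shows "(\<integral>z. tilt c N z \<partial>\<mu>) = 1"
proof (rule LIMSEQ_unique[OF riesz_product_tendsto[OF assms continuous_tilt]])
  have "\<forall>\<^sub>F M in sequentially. (\<integral>z. riesz_density M z * tilt c N z \<partial>sphere_measure) = 1"
    using eventually_ge_at_top[of N] by eventually_elim (rule integral_density_tilt)
  then show "(\<lambda>M. \<integral>z. riesz_density M z * tilt c N z \<partial>sphere_measure) \<longlonglongrightarrow> 1"
    by (rule tendsto_eventually)
qed

lemma abs_osc_ctr_le:
  assumes "k \<ge> 1" "norm z = 1"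
  shows "\<bar>osc_ctr k z\<bar> \<le> 3 / 2"
proof -
  have "norm (osc k z) \<le> 1" using norm_osc_le[OF assms] norm_a[OF assms(1)] by simp
  then have "(norm (osc k z))\<^sup>2 \<le> 1" by (intro power_le_one) auto
  moreover have "\<bar>osc_re k z\<bar> \<le> 1" using abs_osc_re_le[OF assms] norm_a[OF assms(1)] by simp
  ultimately show ?thesis
    unfolding osc_ctr_def using zero_le_power2[of "norm (osc k z)"] by linarith
qed

text \<open>\<open>ln (1 + t) \<ge> t - 2 * t\<^sup>2\<close> for
  \<open>\<bar>t\<bar> \<le> 1 / 2\<close>, applied to \<open>t = c * osc_ctr k z\<close>. As
  \<open>\<bar>osc_ctr k z\<bar> \<le> 3 / 2\<close>, the condition \<open>c \<le> 1 / 3\<close>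
  suffices and the error is at most \<open>9 / 2 * c\<^sup>2\<close>.\<close>

lemma tilt_lower_bound:
  assumes c: "0 < c" "c \<le> 1 / 3" and z: "norm z = 1"
  shows "exp (c * (\<Sum>k\<in>{0<..N}. osc_ctr k z) - 9 / 2 * c\<^sup>2 * N) \<le> tilt c N z"
proof -
  have "exp (c * osc_ctr k z - 9 / 2 * c\<^sup>2) \<le> 1 + c * osc_ctr k z" if "k \<ge> 1" for k
  proof -
    let ?t = "c * osc_ctr k z"
    have y: "\<bar>osc_ctr k z\<bar> \<le> 3 / 2" by (rule abs_osc_ctr_le[OF that z])
    have "\<bar>?t\<bar> \<le> c * (3 / 2)" unfolding abs_mult using c y by (intro mult_mono) auto
    moreover have "c * (3 / 2) \<le> 1 / 2" using c by simp
    ultimately have t: "\<bar>?t\<bar> \<le> 1 / 2" by linarith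
    have "?t\<^sup>2 \<le> (c * (3 / 2))\<^sup>2"
      using \<open>\<bar>?t\<bar> \<le> c * (3 / 2)\<close> c by (metis abs_ge_zero power2_abs power_mono)
    then have "2 * ?t\<^sup>2 \<le> 9 / 2 * c\<^sup>2" by (simp add: power_mult_distrib power2_eq_square)
    moreover have "\<bar>ln (1 + ?t) - ?t\<bar> \<le> 2 * ?t\<^sup>2"
      using abs_ln_one_plus_x_minus_x_bound[OF t] .
    ultimately have "?t - 9 / 2 * c\<^sup>2 \<le> ln (1 + ?t)" by linarith
    then have "exp (?t - 9 / 2 * c\<^sup>2) \<le> exp (ln (1 + ?t))" by simp
    also have "\<dots> = 1 + ?t" using t by (intro exp_ln) linarith
    finally show ?thesis .
  qed
  then have "(\<Prod>k\<in>{0<..N}. exp (c * osc_ctr k z - 9 / 2 * c\<^sup>2)) \<le> tilt c N z"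
    unfolding tilt_def by (intro prod_mono) auto
  then show ?thesis
    by (simp add: exp_sum[symmetric] sum_subtractf sum_distrib_left mult_ac)
qed

text \<open>The tilts have mean 1, so by Markov and Borel-Cantelli they eventually stay below
  \<open>(N + 1)^2\<close>. Taking logarithms and dividing by \<open>c\<close> leaves a logarithmic
  term and a term linear in \<open>N\<close> with slope \<open>9 / 2 * c\<close>.\<close>

lemma AE_osc_sum_le:
  fixes e :: real
  assumes \<mu>: "riesz_product R J a \<mu>" and e: "e > 0"
  shows "AE z in \<mu>. \<forall>\<^sub>F N in sequentially.
    osc_sum N z \<le> (\<Sum>k\<in>{0<..N}. (norm (a k))\<^sup>2) / 2 + e * N"
proof -
  have sets: "sets \<mu> = sets (restrict_space borel (sphere 0 1))" and "prob_space \<mu>"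
    using \<mu> by (auto simp: riesz_product_def)
  then interpret prob_space \<mu> by simp
  have space: "space \<mu> = sphere 0 1"
    using sets_eq_imp_space_eq[OF sets] by (simp add: space_restrict_space)
  \<comment> \<open>The bound \<open>1 / 3\<close> serves \<open>tilt_lower_bound\<close>;
    \<open>e / 9\<close> makes the linear error at most half of \<open>e * N\<close>, the other half
    absorbing the logarithm.\<close>
  define c where "c = min (1 / 3) (e / 9)"
  have c: "0 < c" "c \<le> 1 / 3" "9 / 2 * c \<le> e / 2" using e by (auto simp: c_def)
  have meas: "tilt c N \<in> borel_measurable \<mu>" for N
    using continuous_on_sphere_measurable[OF continuous_tilt] sets by (simp cong: measurable_cong_sets)
  have tilt_nonneg: "0 \<le> tilt c N z" if "norm z = 1" for N z
    using tilt_lower_bound[OF c(1,2) that, of N] exp_ge_zero order_trans by blast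
  have tilt_AE: "AE z in \<mu>. 0 \<le> tilt c N z" for N
    using tilt_nonneg by (intro AE_I2) (simp add: space)
  have int: "integrable \<mu> (tilt c N)" for N
    \<comment> \<open>A function that is not integrable has integral 0 by convention, whereas this
      integral is 1.\<close>
    using riesz_product_integral_tilt[OF \<mu>, of c N] not_integrable_integral_eq by fastforce
  let ?A = "\<lambda>N. {z \<in> space \<mu>. tilt c N z \<ge> (real (Suc N))\<^sup>2}"
  have A: "?A N \<in> sets \<mu>" for N using meas[of N] by measurable
  have bc: "AE z in \<mu>. \<forall>\<^sub>F N in sequentially. z \<in> space \<mu> - ?A N"
  proof (rule borel_cantelli_AE1)
    show "emeasure \<mu> (?A N) < \<infinity>" for N by (simp add: emeasure_eq_measure)
    have le: "measure \<mu> (?A N) \<le> inverse ((real (Suc N))\<^sup>2)" for N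
      using tilt_AE integral_Markov_inequality_measure[OF int[of N], of "{}" "(real (Suc N))\<^sup>2"]
        riesz_product_integral_tilt[OF \<mu>, of c N] tilt_nonneg
      by (simp add: space inverse_eq_divide)
    have "summable (\<lambda>N. inverse ((real (Suc N))\<^sup>2))"
      using inverse_power_summable[of 2, where 'a = real] by (subst summable_Suc_iff) simp
    then show "summable (\<lambda>N. measure \<mu> (?A N))"
      by (rule summable_comparison_test'[where N = 0]) (use le in simp)
  qed (rule A)
  have log_small: "\<forall>\<^sub>F N in sequentially. 2 * ln (real (Suc N)) / c \<le> e / 2 * real N"
    using c(1) e by real_asymp
  have le: "\<forall>\<^sub>F N in sequentially. osc_sum N z \<le> (\<Sum>k\<in>{0<..N}. (norm (a k))\<^sup>2) / 2 + e * N"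
    if z: "norm z = 1" and ev: "\<forall>\<^sub>F N in sequentially. tilt c N z < (real (Suc N))\<^sup>2" for z
    using log_small ev
  proof eventually_elim
    case (elim N)
    let ?Y = "\<Sum>k\<in>{0<..N}. osc_ctr k z"
    have "exp (c * ?Y - 9 / 2 * c\<^sup>2 * N) \<le> (real (Suc N))\<^sup>2"
      using tilt_lower_bound[OF c(1,2) z, of N] elim by linarith
    also have "(real (Suc N))\<^sup>2 = exp (2 * ln (real (Suc N)))"
      using exp_of_nat_mult[of 2 "ln (real (Suc N))"] by simp
    finally have "c * ?Y \<le> 2 * ln (real (Suc N)) + 9 / 2 * c\<^sup>2 * N" by simp
    then have "?Y \<le> (2 * ln (real (Suc N)) + 9 / 2 * c\<^sup>2 * N) / c"
      using c(1) by (simp add: pos_le_divide_eq mult.commute)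
    also have "\<dots> = 2 * ln (real (Suc N)) / c + 9 / 2 * c * N"
      using c(1) by (simp add: add_divide_distrib power2_eq_square)
    also have "\<dots> \<le> e / 2 * N + e / 2 * N"
      using elim c(3) by (intro add_mono mult_right_mono) auto
    finally have Y: "?Y \<le> e * N" by simp
    have "osc_sum N z = ?Y + (\<Sum>k\<in>{0<..N}. (norm (osc k z))\<^sup>2) / 2"
      by (simp add: osc_sum_def osc_ctr_def sum_subtractf sum_divide_distrib)
    also have "(\<Sum>k\<in>{0<..N}. (norm (osc k z))\<^sup>2) \<le> (\<Sum>k\<in>{0<..N}. (norm (a k))\<^sup>2)"
      using norm_osc_le z by (intro sum_mono power_mono) auto
    finally show ?case using Y by simp
  qed
  show ?thesis using bc
  proof eventually_elim
    case (elim z)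
    \<comment> \<open>Membership in the sphere is read off from the eventual statement at some index
      \<open>N\<close>.\<close>
    have "norm z = 1" using eventually_happens[OF elim] by (auto simp: space)
    moreover have "\<forall>\<^sub>F N in sequentially. tilt c N z < (real (Suc N))\<^sup>2"
      using elim by eventually_elim (auto simp: not_le)
    ultimately show ?case by (rule le)
  qed
qed

section \<open>The dimension bound\<close>


text \<open>Each step multiplies \<open>J\<close> by at least 3, so its logarithm grows by at least
  1. This converts an error \<open>e * N\<close> into a small multiple of
  \<open>ln (J N)\<close>.\<close>

lemma real_le_ln_J: "N \<ge> 1 \<Longrightarrow> real N \<le> 1 + ln (real (J N))"
proof (induction N rule: nat_induct_at_least)
  case base
  then show ?case using J_ge_1[of 1] by simp
next
  case (Suc N)
  have J: "J N \<ge> 1" "3 * J N \<le> J (Suc N)" using Suc J_ge_1 J_Suc by auto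
  have "exp 1 \<le> (3 :: real)" using exp_le by simp
  then have "1 \<le> ln (3 :: real)" by (subst ln_ge_iff) auto
  then have "1 + ln (real (J N)) \<le> ln (real (3 * J N))"
    using J by (simp add: ln_mult)
  also have "\<dots> \<le> ln (real (J (Suc N)))"
    using J by (intro ln_mono) (auto simp only: of_nat_le_iff of_nat_0_less_iff)
  finally show ?case using Suc by simp
qed

text \<open>Chooses how many factors count as slowly varying at scale \<open>1 / T\<close>. The
  least \<open>N \<ge> N0\<close> with \<open>T < J (Suc N)\<close> exists because
  \<open>J N \<ge> N\<close>; minimality, or the hypothesis when \<open>N = N0\<close>, gives the
  lower bound.\<close>

lemma J_bracket:
  assumes "N0 \<ge> 1" "real (J N0) \<le> T"
  obtains N where "N \<ge> N0" "real (J N) \<le> T" "T \<le> real (J (Suc N))"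
proof -
  have J: "real N \<le> real (J N)" if "N \<ge> 1" for N
    using real_le_ln_J[OF that] J_ge_1[OF that] ln_le_minus_one[of "real (J N)"] by simp
  obtain m where "T < real m" using reals_Archimedean2 by blast
  then have "T < real (J (Suc (m + N0)))" using J[of "Suc (m + N0)"] by simp
  then have ex: "\<exists>N. N \<ge> N0 \<and> T < real (J (Suc N))" by (intro exI[of _ "m + N0"]) simp
  define N where "N = (LEAST N. N \<ge> N0 \<and> T < real (J (Suc N)))"
  have N: "N \<ge> N0" "T < real (J (Suc N))" using LeastI_ex[OF ex] by (auto simp: N_def)
  have "real (J N) \<le> T"
  proof (cases "N = N0")
    case False
    then have "N - 1 < N" "N0 \<le> N - 1" "Suc (N - 1) = N" using N(1) assms(1) by auto
    then show ?thesis using not_less_Least[of "N - 1" "\<lambda>N. N \<ge> N0 \<and> T < real (J (Suc N))"]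
      by (auto simp: N_def[symmetric])
  qed (use assms in simp)
  then show ?thesis using that N by simp
qed

text \<open>At the scale selected by \<open>J_bracket\<close>, the ball estimate and the almost sure
  bound on \<open>osc_sum\<close> give the decay required by the mass distribution
  principle.\<close>

lemma riesz_product_hausdorff_measure_neq_0:
  assumes \<mu>: "riesz_product R J a \<mu>" and E: "E \<in> sets \<mu>" "emeasure \<mu> E > 0" and s: "0 \<le> s"
    and t: "limsup (\<lambda>k. ereal (1 / (2 * ln (real (J k))) * (\<Sum>l\<in>{1..<k}. (norm (a l))\<^sup>2))) < ereal t"
    and st: "s + t < 2 * real CARD('n) - 1"
  shows "hausdorff_measure s E \<noteq> 0"
proof -
  have sets: "sets \<mu> = sets (restrict_space borel (sphere 0 1))" and "prob_space \<mu>"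
    using \<mu> by (auto simp: riesz_product_def)
  then interpret prob_space \<mu> by simp
  have space: "space \<mu> = sphere 0 1"
    using sets_eq_imp_space_eq[OF sets] by (simp add: space_restrict_space)
  \<comment> \<open>The gap is \<open>2 * e\<close>: one \<open>e\<close> pays for the law of large
    numbers, the other makes the exponent \<open>s' = s + e\<close> exceed \<open>s\<close>.\<close>
  define e where "e = (2 * real CARD('n) - 1 - s - t) / 2"
  \<comment> \<open>The \<open>1 / 2\<close> pays for the last coefficient in \<open>energy\<close>,
    the \<open>e\<close> for the constant in \<open>real_le_ln_J\<close>.\<close>
  define \<kappa> where "\<kappa> = 1 / 2 + e"
  have e: "e > 0" using st by (simp add: e_def)
  have ev: "\<forall>\<^sub>F N in sequentially. 1 / (2 * ln (real (J N))) * (\<Sum>l\<in>{1..<N}. (norm (a l))\<^sup>2) < t"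
    using Limsup_lessD[OF t] by simp
  have ln_pos: "ln (real (J N)) > 0" if "N \<ge> 2" for N
    using real_le_ln_J[of N] that by simp
  \<comment> \<open>Positivity of \<open>t\<close> is extracted from the nonnegative averages; it
    makes the power with exponent \<open>t + e\<close> monotone further down.\<close>
  obtain N where "1 / (2 * ln (real (J N))) * (\<Sum>l\<in>{1..<N}. (norm (a l))\<^sup>2) < t" "N \<ge> 2"
    using eventually_happens[OF eventually_conj[OF ev eventually_ge_at_top[of 2]]] by auto
  moreover from this have "0 \<le> 1 / (2 * ln (real (J N))) * (\<Sum>l\<in>{1..<N}. (norm (a l))\<^sup>2)"
    using ln_pos[of N] by (intro mult_nonneg_nonneg sum_nonneg) auto
  ultimately have t0: "t > 0" by linarith
  \<comment> \<open>The averages stop at index \<open>N - 1\<close> while \<open>osc_sum N\<close>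
    includes \<open>N\<close>; the extra term is at most \<open>1 / 2\<close>. Starting at 2 keeps
    \<open>ln (J N)\<close> positive.\<close>
  have energy: "\<forall>\<^sub>F N in sequentially. (\<Sum>k\<in>{0<..N}. (norm (a k))\<^sup>2) / 2 \<le> t * ln (real (J N)) + 1 / 2"
    using ev eventually_ge_at_top[of 2]
  proof eventually_elim
    case (elim N)
    have "(norm (a N))\<^sup>2 \<le> 1" using norm_a[of N] elim by (intro power_le_one) auto
    moreover have "(\<Sum>l\<in>{1..<N}. (norm (a l))\<^sup>2) / 2 < t * ln (real (J N))"
      using elim ln_pos[of N] by (simp add: field_simps)
    moreover have "{0<..N} = insert N {1..<N}" using elim by auto
    ultimately show ?case by simp
  qed
  \<comment> \<open>The almost sure bound starts at an index depending on the point. Fixing the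
    index gives countably many sets covering almost all of \<open>E\<close>, so one of them has
    positive measure and a uniform bound.\<close>
  define good where "good N0 = {z \<in> E. \<forall>N\<ge>N0. osc_sum N z \<le> (t + e) * ln (real (J N)) + \<kappa>}" for N0
  have "osc_sum N \<in> borel_measurable \<mu>" for N
    using continuous_on_sphere_measurable[OF continuous_osc_sum] sets by (simp cong: measurable_cong_sets)
  then have "{z \<in> space \<mu>. \<forall>N\<ge>N0. osc_sum N z \<le> (t + e) * ln (real (J N)) + \<kappa>} \<in> sets \<mu>" for N0
    by measurable
  then have "E \<inter> {z \<in> space \<mu>. \<forall>N\<ge>N0. osc_sum N z \<le> (t + e) * ln (real (J N)) + \<kappa>} \<in> sets \<mu>" for N0
    using E(1) by blast
  moreover have "good N0 = E \<inter> {z \<in> space \<mu>. \<forall>N\<ge>N0. osc_sum N z \<le> (t + e) * ln (real (J N)) + \<kappa>}" for N0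
    using sets.sets_into_space[OF E(1)] by (auto simp: good_def)
  ultimately have good: "good N0 \<in> sets \<mu>" for N0 by simp
  have "AE z in \<mu>. z \<in> E \<longrightarrow> z \<in> (\<Union>N0. good N0)"
    using AE_osc_sum_le[OF \<mu> e]
  proof eventually_elim
    case (elim z)
    have "\<forall>\<^sub>F N in sequentially. osc_sum N z \<le> (t + e) * ln (real (J N)) + \<kappa>"
      using elim energy eventually_ge_at_top[of 1]
    proof eventually_elim
      case (elim N)
      have "e * real N \<le> e * (1 + ln (real (J N)))"
        using real_le_ln_J[of N] elim e by (intro mult_left_mono) auto
      then show ?case using elim by (simp add: \<kappa>_def algebra_simps)
    qed
    then show ?case by (auto simp: good_def eventually_sequentially)
  qed
  then have "emeasure \<mu> E \<le> emeasure \<mu> (\<Union>N0. good N0)"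
    using good by (intro emeasure_mono_AE) auto
  then have "emeasure \<mu> (\<Union>N0. good N0) \<noteq> 0" using E(2) by auto
  then obtain N0 where N0: "emeasure \<mu> (good N0) \<noteq> 0"
    using good by (metis emeasure_UN_eq_0 image_subset_iff UNIV_I)
  define N1 where "N1 = max N0 1"
  have N1: "N1 \<ge> 1" "N1 \<ge> N0" by (simp_all add: N1_def)
  obtain K where K: "K > 0"
    "\<And>w r N. norm w = 1 \<Longrightarrow> 0 < r \<Longrightarrow> 2 * r \<le> 1 \<Longrightarrow> N \<ge> 1 \<Longrightarrow> J N \<le> 1 / (2 * r) \<Longrightarrow>
      1 / (2 * r) \<le> J (Suc N) \<Longrightarrow>
      measure \<mu> (cball w r \<inter> sphere 0 1)
        \<le> K * (2 * r) ^ (2 * CARD('n) - 1) * exp (osc_sum N w)"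
    by (rule riesz_product_cball_le[OF \<mu>]) blast
  define s' where "s' = s + e"
  show ?thesis
  \<comment> \<open>The value of \<open>d\<close> ensures \<open>J N1 \<le> 1 / (2 * r)\<close>, so
    the index chosen for \<open>r\<close> is at least \<open>N1\<close>, where the bound on
    \<open>good N0\<close> is in force.\<close>
  proof (rule mass_distribution_principle[where \<mu> = \<mu> and S = "sphere 0 1" and A = "good N0"
        and s' = s' and d = "1 / (2 * real (J N1))" and C = "K * exp \<kappa> * 2 powr s'"])
    show "emeasure \<mu> (good N0) > 0" using N0 by (simp add: zero_less_iff_neq_zero)
    show "good N0 \<subseteq> E" by (auto simp: good_def)
    show "0 < 1 / (2 * real (J N1))" "1 / (2 * real (J N1)) \<le> 1"
      using J_ge_1[OF N1(1)] by auto
    fix w r assume w: "w \<in> good N0" and r: "0 < r" "r \<le> 1 / (2 * real (J N1))"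
    have "w \<in> E" using w by (simp add: good_def)
    then have w1: "norm w = 1" using sets.sets_into_space[OF E(1)] space by auto
    have J1: "real (J N1) \<ge> 1" using J_ge_1[OF N1(1)] by simp
    have "real (J N1) \<le> 1 / (2 * r)" using r J1 by (simp add: field_simps)
    then obtain N where N: "N \<ge> N1" "real (J N) \<le> 1 / (2 * r)" "1 / (2 * r) \<le> real (J (Suc N))"
      using J_bracket[OF N1(1)] by blast
    have "1 \<le> 1 / (2 * r)" using \<open>real (J N1) \<le> 1 / (2 * r)\<close> J1 by linarith
    then have r1: "2 * r \<le> 1" using r by (simp add: field_simps)
    have JN: "real (J N) \<ge> 1" using J_ge_1[of N] N N1 by simp
    have "exp (osc_sum N w) \<le> exp ((t + e) * ln (real (J N)) + \<kappa>)"
      using w N N1 by (simp add: good_def)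
    also have "\<dots> = exp \<kappa> * real (J N) powr (t + e)"
      using JN by (simp add: powr_def exp_add)
    also have "\<dots> \<le> exp \<kappa> * (1 / (2 * r)) powr (t + e)"
      using N(2) t0 e by (intro mult_left_mono powr_mono2) auto
    also have "(1 / (2 * r)) powr (t + e) = (2 * r) powr (- (t + e))"
      using r by (simp add: powr_minus_divide powr_divide del: minus_add_distrib)
    finally have S: "exp (osc_sum N w) \<le> exp \<kappa> * (2 * r) powr (- (t + e))" .
    have n: "real (2 * CARD('n) - 1) = 2 * real CARD('n) - 1" by (simp add: of_nat_diff)
    have pow: "(2 * r) powr real (2 * CARD('n) - 1) = (2 * r) ^ (2 * CARD('n) - 1)"
      using r by (intro powr_realpow) simp
    have "measure \<mu> (cball w r \<inter> sphere 0 1) \<le> K * (2 * r) ^ (2 * CARD('n) - 1) * exp (osc_sum N w)"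
      using N N1 by (intro K(2) w1 r r1) auto
    also have "\<dots> \<le> K * (2 * r) ^ (2 * CARD('n) - 1) * (exp \<kappa> * (2 * r) powr (- (t + e)))"
      using S K(1) r by (intro mult_left_mono) auto
    also have "(2 * r) ^ (2 * CARD('n) - 1) = (2 * r) powr (2 * real CARD('n) - 1)"
      using pow[unfolded n] by (rule sym)
    also have "K * (2 * r) powr (2 * real CARD('n) - 1) * (exp \<kappa> * (2 * r) powr (- (t + e))) =
      K * exp \<kappa> * (2 * r) powr (2 * real CARD('n) - 1 + - (t + e))"
      by (simp only: powr_add mult_ac)
    also have "2 * real CARD('n) - 1 + - (t + e) = s'"
      by (simp add: s'_def e_def field_simps)
    also have "K * exp \<kappa> * (2 * r) powr s' = K * exp \<kappa> * 2 powr s' * r powr s'"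
      using r by (simp add: powr_mult)
    finally show "emeasure \<mu> (cball w r \<inter> sphere 0 1) \<le> ennreal (K * exp \<kappa> * 2 powr s' * r powr s')"
      by (simp add: emeasure_eq_measure ennreal_leI)
  qed (use K(1) e s good sets in \<open>auto simp: s'_def finite_measure_axioms\<close>)
qed

end

theorem theorem1p3:
  fixes R :: "nat \<Rightarrow> complex ^ 'n \<Rightarrow> complex"
    and J :: "nat \<Rightarrow> nat"
    and a :: "nat \<Rightarrow> complex"
    and \<mu> :: "(complex ^ 'n) measure"
  assumes "CARD('n) \<ge> 2"
    and "riesz_triple R J a"
    and "riesz_product R J a \<mu>"
  shows "hausdorff_dim_measure \<mu> \<ge>
    ereal (2 * real CARD('n) - 1) -
    limsup (\<lambda>k. ereal (1 / (2 * ln (real (J k))) * (\<Sum>l\<in>{1..<k}. (norm (a l))\<^sup>2)))"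
proof -
  interpret riesz R J a using assms(2) by unfold_locales
  define L where "L = limsup (\<lambda>k. ereal (1 / (2 * ln (real (J k))) * (\<Sum>l\<in>{1..<k}. (norm (a l))\<^sup>2)))"
  have "ereal (2 * real CARD('n) - 1) - L \<le> ereal s"
    if E: "E \<in> sets \<mu>" "emeasure \<mu> E > 0" and s: "0 \<le> s" "hausdorff_measure s E = 0" for E s
  proof (rule ccontr)
    assume "\<not> ?thesis"
    \<comment> \<open>For \<open>L = \<infinity>\<close> the lower bound is minus infinity and
      cannot fail, so \<open>L\<close> is finite or minus infinity here.\<close>
    then have "L < ereal (2 * real CARD('n) - 1 - s)" by (cases L) auto
    then obtain t where "L < ereal t" "ereal t < ereal (2 * real CARD('n) - 1 - s)"
      using ereal_dense2 by blast
    then show False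
      using riesz_product_hausdorff_measure_neq_0[OF assms(3) E s(1), of t] s(2)
      by (simp add: L_def)
  qed
  then show ?thesis
    unfolding hausdorff_dim_measure_def hausdorff_dim_def L_def[symmetric]
    by (auto intro!: INF_greatest Inf_greatest)
qed

end
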